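(* Let $\gamma_1,\gamma_2$ be the instantaneous SNRs of the RF hop (Rayleigh fading with partial relay selection and outdated CSI) and of the optical hop (Málaga turbulence with pointing error) described in the context, let $\kappa_1,\kappa_2\ge 0$ be the hardware impairment levels, and let $$\gamma=\frac{\gamma_1\gamma_2}{\delta\,\gamma_1\gamma_2+(1+\kappa_2^2)\gamma_2+C},\qquad \delta=\kappa_1^2+\kappa_2^2+\kappa_1^2\kappa_2^2,\qquad C=\mathbb{E}[\gamma_1](1+\kappa_1^2)+1,$$ be the end-to-end signal-to-noise-plus-distortion ratio of amplify-and-forward relaying with non-ideal hardware. Let $\overline{C}=\mathbb{E}[\log_2(1+\varpi\gamma)]$ be the ergodic capacity, where $\varpi=1$ if $r=1$ (heterodyne detection) and $\varpi=\frac{e}{2\pi}$ if $r=2$ (IM/DD). Then $$\overline{C}\le \log_2\left(1+\frac{\varpi\,\mathcal{I}}{\delta\,\mathcal{I}+1}\right),\qquad \mathcal{I}:=\mathbb{E}\left[\frac{\gamma_1\gamma_2}{(1+\kappa_2^2)\gamma_2+C}\right],$$ and $\mathcal{I}$ is given by $$\mathcal{I}=\frac{\xi^2A\,\mathbb{E}[\gamma_1]}{2^r(2\pi)^{r-1}(1+\kappa_2^2)}\sum_{n=1}^{\beta}b_n\,r^{\alpha+n-1}\,G_{r+1,3r+1}^{3r+1,1}\left(\left(\frac{B}{r^2}\right)^r\frac{C}{(1+\kappa_2^2)\mu_r}\;\middle|\;\begin{matrix}0,\ \tau_5\\ \tau_4\end{matrix}\right),$$ where $\tau_5=\Delta(r:\xi^2+1)$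 and $\tau_4=[\Delta(r:\xi^2),\Delta(r:\alpha),\Delta(r:n),0]$ (so $\tau_4$ depends on $n$).
   Context: Notation. $\Delta(j:x)$ denotes the list $\frac{x}{j},\frac{x+1}{j},\dots,\frac{x+j-1}{j}$. $G_{p,q}^{m,n}\left(z\,\middle|\,\begin{matrix}a_1,\dots,a_p\\ b_1,\dots,b_q\end{matrix}\right)$ is the Meijer G-function with the standard convention $\frac{1}{2\pi i}\int \frac{\prod_{j=1}^m\Gamma(b_j+s)\prod_{j=1}^n\Gamma(1-a_j-s)}{\prod_{j=m+1}^q\Gamma(1-b_j-s)\prod_{j=n+1}^p\Gamma(a_j+s)}z^{-s}ds$, the contour separating the poles of the $\Gamma(b_j+s)$ from those of the $\Gamma(1-a_j-s)$. RF hop. $M\ge1$ is the number of relays, $1\le m\le M$ the rank of the selected relay, $\rho_m\in[0,1]$ the time correlation coefficient between outdated and actual CSI, $\mu_1>0$ the average SNR of the first hop. $\gamma_1$ is a nonnegative random variable with density, for $x\ge0$, $$f_{\gamma_1}(x)=m\binom{M}{m}\sum_{k=0}^{m-1}\frac{(-1)^k\binom{m-1}{k}}{[(M-m+k)(1-\rho_m)+1]\mu_1}\exp\left(-\frac{(M-m+k+1)x}{[(M-m+k)(1-\rho_m)+1]\mu_1}\right),$$ so that $\mathbb{E}[\gamma_1]=m\binom{M}{m}\sum_{k=0}^{m-1}\binom{m-1}{k}(-1)^k\frac{[(M-m+k)(1-\rho_m)+1]\mu_1}{(M-m+k+1)^2}$. Optical hop. $r\in\{1,2\}$ is the detection type,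 $\mu_r>0$ the average electrical SNR, $\xi>0$ the pointing error coefficient, $\alpha>0$, $\beta$ a positive integer, $g>0$, $\Omega'>0$ the Málaga turbulence parameters, $B>0$ a constant of the fading law. Put $$A=\frac{2\alpha^{\alpha/2}}{g^{1+\alpha/2}\Gamma(\alpha)}\left(\frac{g\beta}{g\beta+\Omega'}\right)^{\beta+\alpha/2},\quad a_n=\binom{\beta-1}{n-1}\frac{(g\beta+\Omega')^{1-n/2}}{(n-1)!}\left(\frac{\Omega'}{g}\right)^{n-1}\left(\frac{\alpha}{\beta}\right)^{n/2},\quad b_n=a_n\left(\frac{g\beta+\Omega'}{\alpha\beta}\right)^{\frac{\alpha+n}{2}}.$$ $\gamma_2$ is a positive random variable, independent of $\gamma_1$, with density for $x>0$ $$f_{\gamma_2}(x)=\frac{\xi^2A}{2^r x}\sum_{n=1}^{\beta}b_n\,G_{1,3}^{3,0}\left(B\left(\frac{x}{\mu_r}\right)^{1/r}\;\middle|\;\begin{matrix}\xi^2+1\\ \xi^2,\ \alpha,\ n\end{matrix}\right).$$ *)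

theory Defs
  imports "HOL-Probability.Probability" "HOL-Complex_Analysis.Complex_Analysis"
begin

text \<open>
  Contours of Mellin--Barnes type, running from \<open>c - i\<infinity>\<close> to \<open>c + i\<infinity>\<close>: the two vertical half-lines
  \<open>Re s = c\<close>, \<open>T \<le> \<bar>Im s\<bar>\<close>, joined by an arbitrary piecewise continuously differentiable path \<open>p\<close>.
  Indented contours are thus allowed, and a straight line is the case where \<open>p\<close> is a segment.
\<close>

definition mb_trace :: "real \<Rightarrow> real \<Rightarrow> (real \<Rightarrow> complex) \<Rightarrow> complex set" where
  "mb_trace c T p = path_image p \<union> {s. Re s = c \<and> T \<le> \<bar>Im s\<bar>}"

definition mb_truncated :: "real \<Rightarrow> real \<Rightarrow> (real \<Rightarrow> complex) \<Rightarrow> real \<Rightarrow> real \<Rightarrow> complex" where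
  "mb_truncated c T p R =
     linepath (Complex c (- R)) (Complex c (- T)) +++ p +++ linepath (Complex c T) (Complex c R)"

definition mb_contour :: "real \<Rightarrow> real \<Rightarrow> (real \<Rightarrow> complex) \<Rightarrow> bool" where
  "mb_contour c T p \<longleftrightarrow>
     T > 0 \<and> valid_path p \<and> pathstart p = Complex c (- T) \<and> pathfinish p = Complex c T"

text \<open>
  A point lies to the left (right) of the contour if it can be joined, off the contour, to the far
  left (right) part of the real axis.
\<close>

definition left_of_contour :: "complex \<Rightarrow> real \<Rightarrow> real \<Rightarrow> (real \<Rightarrow> complex) \<Rightarrow> bool" where
  "left_of_contour q c T p \<longleftrightarrow>
     (\<forall>\<^sub>F x::real in at_top. connected_component (- mb_trace c T p) q (of_real (- x)))"

definition right_of_contour :: "complex \<Rightarrow> real \<Rightarrow> real \<Rightarrow> (real \<Rightarrow> complex) \<Rightarrow> bool" where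
  "right_of_contour q c T p \<longleftrightarrow>
     (\<forall>\<^sub>F x::real in at_top. connected_component (- mb_trace c T p) q (of_real x))"

text \<open>
  The numbers \<open>p\<close> and \<open>q\<close> of the notation \<open>G\<^sub>p\<^sub>,\<^sub>q\<close> are the lengths of the parameter lists.
  Since \<open>Gamma\<close> is \<open>0\<close> at its poles and \<open>x / 0 = 0\<close>, dividing by \<open>Gamma\<close> is the same as
  multiplying by the entire function \<open>rGamma\<close>.
\<close>

definition meijer_integrand ::
    "nat \<Rightarrow> nat \<Rightarrow> complex list \<Rightarrow> complex list \<Rightarrow> complex \<Rightarrow> complex \<Rightarrow> complex" where
  "meijer_integrand m n as bs z s =
     ((\<Prod>j<m. Gamma (bs ! j + s)) * (\<Prod>j<n. Gamma (1 - as ! j - s))) /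
     ((\<Prod>j=m..<length bs. Gamma (1 - bs ! j - s)) * (\<Prod>j=n..<length as. Gamma (as ! j + s)))
     * z powr (- s)"

definition meijer_contour ::
    "nat \<Rightarrow> nat \<Rightarrow> complex list \<Rightarrow> complex list \<Rightarrow> real \<Rightarrow> real \<Rightarrow> (real \<Rightarrow> complex) \<Rightarrow> bool" where
  "meijer_contour m n as bs c T p \<longleftrightarrow>
     mb_contour c T p \<and>
     (\<forall>j<m. \<forall>k::nat. left_of_contour (- (bs ! j) - of_nat k) c T p) \<and>
     (\<forall>j<n. \<forall>k::nat. right_of_contour (1 - as ! j + of_nat k) c T p)"

text \<open>
  The value does not depend on the choice of the separating contour when the integrand decays
  exponentially in vertical strips (\<open>p + q < 2 * (m + n)\<close>, \<open>z > 0\<close>). Loop contours, which are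
  customary when the integral between \<open>- i\<infinity>\<close> and \<open>i\<infinity>\<close> diverges, are not considered.
\<close>

definition meijer_G ::
    "nat \<Rightarrow> nat \<Rightarrow> complex list \<Rightarrow> complex list \<Rightarrow> complex \<Rightarrow> complex" where
  "meijer_G m n as bs z =
     (THE I. \<exists>c T p. meijer_contour m n as bs c T p \<and>
        ((\<lambda>R. contour_integral (mb_truncated c T p R) (meijer_integrand m n as bs z)
               / (2 * of_real pi * \<i>)) \<longlongrightarrow> I) at_top)"

definition Delta :: "nat \<Rightarrow> real \<Rightarrow> real list" where
  "Delta j x = map (\<lambda>i. (x + real i) / real j) [0..<j]"

definition has_density :: "'a measure \<Rightarrow> ('a \<Rightarrow> real) \<Rightarrow> (real \<Rightarrow> real) \<Rightarrow> bool" where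
  "has_density P X f \<longleftrightarrow>
     (AE x in lborel. 0 \<le> f x) \<and> distributed P lborel X (\<lambda>x. ennreal (f x))"

definition rf_density :: "nat \<Rightarrow> nat \<Rightarrow> real \<Rightarrow> real \<Rightarrow> real \<Rightarrow> real" where
  "rf_density M m \<rho> \<mu> x =
     (if x \<ge> 0 then
        real m * real (M choose m) *
        (\<Sum>k=0..m-1. (- 1) ^ k * real ((m - 1) choose k)
            / ((real (M - m + k) * (1 - \<rho>) + 1) * \<mu>)
            * exp (- (real (M - m + k + 1) * x) / ((real (M - m + k) * (1 - \<rho>) + 1) * \<mu>)))
      else 0)"

definition malaga_A :: "real \<Rightarrow> nat \<Rightarrow> real \<Rightarrow> real \<Rightarrow> real" where
  "malaga_A \<alpha> \<beta> g \<Omega> =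
     2 * \<alpha> powr (\<alpha> / 2) / (g powr (1 + \<alpha> / 2) * Gamma \<alpha>)
     * (g * real \<beta> / (g * real \<beta> + \<Omega>)) powr (real \<beta> + \<alpha> / 2)"

definition malaga_a :: "real \<Rightarrow> nat \<Rightarrow> real \<Rightarrow> real \<Rightarrow> nat \<Rightarrow> real" where
  "malaga_a \<alpha> \<beta> g \<Omega> n =
     real ((\<beta> - 1) choose (n - 1)) * (g * real \<beta> + \<Omega>) powr (1 - real n / 2) / fact (n - 1)
     * (\<Omega> / g) ^ (n - 1) * (\<alpha> / real \<beta>) powr (real n / 2)"

definition malaga_b :: "real \<Rightarrow> nat \<Rightarrow> real \<Rightarrow> real \<Rightarrow> nat \<Rightarrow> real" where
  "malaga_b \<alpha> \<beta> g \<Omega> n =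
     malaga_a \<alpha> \<beta> g \<Omega> n * ((g * real \<beta> + \<Omega>) / (\<alpha> * real \<beta>)) powr ((\<alpha> + real n) / 2)"

text \<open>The Meijer function has real parameters and a positive argument here, hence is real.\<close>

definition optical_density ::
    "nat \<Rightarrow> real \<Rightarrow> real \<Rightarrow> real \<Rightarrow> nat \<Rightarrow> real \<Rightarrow> real \<Rightarrow> real \<Rightarrow> real \<Rightarrow> real" where
  "optical_density r \<mu> \<xi> \<alpha> \<beta> g \<Omega> B x =
     (if x > 0 then
        \<xi>\<^sup>2 * malaga_A \<alpha> \<beta> g \<Omega> / (2 ^ r * x) *
        (\<Sum>n=1..\<beta>. malaga_b \<alpha> \<beta> g \<Omega> n *
           Re (meijer_G 3 0
                 [of_real (\<xi>\<^sup>2 + 1)]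
                 [of_real (\<xi>\<^sup>2), of_real \<alpha>, of_nat n]
                 (of_real (B * (x / \<mu>) powr (1 / real r)))))
      else 0)"

end

theory Submission imports Defs "HOL-Real_Asymp.Real_Asymp" begin

text \<open>
  The Meijer integrands are holomorphic off their (real) poles and decay in vertical strips: the
  recurrence of \<open>Gamma\<close> gives every polynomial rate from \<open>\<bar>Gamma s\<bar> \<le> Gamma (Re s)\<close>. Each separating
  contour can therefore be moved to a vertical line by the homology form of Cauchy's theorem, and the
  Meijer function is an absolutely convergent line integral.

  Under the expectation over the optical hop, Fubini's theorem reduces the ratio to the Stieltjes
  transform of a power, \<open>\<integral> x powr (- w) / (x + D) = Gamma w * Gamma (1 - w) * D powr (- w)\<close>, which supplies
  the two additional Gamma factors; for \<open>r = 2\<close> the duplication formula splits the Gamma factors at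
  \<open>2 s\<close> into the lists \<open>Delta 2\<close>. The bound is Jensen's inequality, because
  \<open>\<gamma> = X / (\<delta> X + 1)\<close> with \<open>X\<close> the ratio whose mean is \<open>I\<close>.
\<close>

section \<open>Independence of the contour\<close>

text \<open>Since \<open>meijer_G\<close> is a definite description, one convenient contour does not
  determine it: every admissible contour, possibly indented or crossing itself, must give the same
  limit. The sides of a contour are described only by joining paths, so each joining path is
  converted into a vanishing winding number, the form that Cauchy's theorem can use. Quadratic decay
  is all that the deformation and the line integrals require, which makes Stirling's formula
  unnecessary. The abscissae come from convergence. The Stieltjes transform needs
  \<open>0 < Re w < 1\<close>, and the power of \<open>x\<close> under the optical contour is
  \<open>w = s / r\<close>; hence the optical function is taken on \<open>Re s = r / 2\<close>, the
  middle of the admissible range. The substitution \<open>s = r t\<close> then lands on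
  \<open>Re t = 1 / 2\<close>, between the poles of \<open>Gamma t\<close> and those of
  \<open>Gamma (1 - t)\<close>. These two factors are the parameters 0 in the two lists of the
  capacity function.\<close>

lemma closed_mb_trace:
  assumes "mb_contour c T p"
  shows "closed (mb_trace c T p)"
proof -
  have "closed {s. Re s = c \<and> T \<le> \<bar>Im s\<bar>}"
    by (intro closed_Collect_conj closed_Collect_eq closed_Collect_le continuous_intros)
  moreover have "closed (path_image p)"
    using assms by (auto simp: mb_contour_def intro!: closed_path_image valid_path_imp_path)
  ultimately show ?thesis unfolding mb_trace_def by blast
qed

lemma vertical_segment_bounds:
  assumes "s \<in> closed_segment (Complex c a) (Complex c b)" "a \<le> b"
  shows "Re s = c" "a \<le> Im s" "Im s \<le> b"
  using assms closed_segment_same_Re[of "Complex c a" "Complex c b"]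
  by (auto simp: closed_segment_eq_real_ivl)

lemma vertical_segment_Re:
  assumes "s \<in> closed_segment (Complex c a) (Complex c b)"
  shows "Re s = c"
  using assms closed_segment_same_Re[of "Complex c a" "Complex c b"] by auto

lemma horizontal_segment:
  assumes "s \<in> closed_segment (Complex a R) (Complex b R)"
  shows "Im s = R" "Re s \<in> closed_segment a b"
  using assms closed_segment_same_Im[of "Complex a R" "Complex b R"] by auto

lemma mb_truncated_basics:
  assumes "mb_contour c T p"
  shows "valid_path (mb_truncated c T p R)"
    and "pathstart (mb_truncated c T p R) = Complex c (- R)"
    and "pathfinish (mb_truncated c T p R) = Complex c R"
  using assms by (auto simp: mb_contour_def mb_truncated_def intro!: valid_path_join)

lemma path_image_mb_truncated:
  assumes "mb_contour c T p" "T \<le> R"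
  shows "path_image (mb_truncated c T p R) \<subseteq> mb_trace c T p"
    and "s \<in> path_image (mb_truncated c T p R) \<Longrightarrow> s \<in> path_image p \<or> Re s = c"
proof -
  have *: "path_image (mb_truncated c T p R) =
     closed_segment (Complex c (- R)) (Complex c (- T)) \<union> path_image p \<union>
     closed_segment (Complex c T) (Complex c R)"
    using assms unfolding mb_truncated_def mb_contour_def
    by (simp add: path_image_join Un_assoc)
  have "s \<in> mb_trace c T p" if "s \<in> closed_segment (Complex c (- R)) (Complex c (- T))" for s
    using vertical_segment_bounds[OF that] assms by (auto simp: mb_trace_def)
  moreover have "s \<in> mb_trace c T p" if "s \<in> closed_segment (Complex c T) (Complex c R)" for s
    using vertical_segment_bounds[OF that] assms by (auto simp: mb_trace_def)
  ultimately show "path_image (mb_truncated c T p R) \<subseteq> mb_trace c T p"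
    unfolding * by (auto simp: mb_trace_def)
  show "s \<in> path_image (mb_truncated c T p R) \<Longrightarrow> s \<in> path_image p \<or> Re s = c"
    unfolding * using vertical_segment_Re[of s] by auto
qed

section \<open>Closing loops and their winding numbers\<close>

definition mb_detour :: "real \<Rightarrow> real \<Rightarrow> real \<Rightarrow> real \<Rightarrow> complex" where
  "mb_detour c R K = linepath (Complex c R) (Complex K R) +++
     linepath (Complex K R) (Complex K (- R)) +++ linepath (Complex K (- R)) (Complex c (- R))"

lemma mb_detour_basics:
  shows "valid_path (mb_detour c R K)"
    and "pathstart (mb_detour c R K) = Complex c R"
    and "pathfinish (mb_detour c R K) = Complex c (- R)"
    and "path_image (mb_detour c R K) = closed_segment (Complex c R) (Complex K R) \<union>
      closed_segment (Complex K R) (Complex K (- R)) \<union>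
      closed_segment (Complex K (- R)) (Complex c (- R))"
  unfolding mb_detour_def
  by (simp_all add: path_image_join Un_assoc)

text \<open>
  Close the contour by a detour through the end of the real axis opposite to the one to which \<open>q\<close> is
  joined. The joining path is compact, so for a large loop it stays off the loop, and its far end lies
  outside the loop.
\<close>

lemma winding_number_mb_detour_eq_0:
  assumes mb: "mb_contour c T p" and \<sigma>: "\<sigma> \<in> {1, - 1 :: real}"
    and conn: "\<forall>\<^sub>F x::real in at_top. connected_component (- mb_trace c T p) q (of_real (- \<sigma> * x))"
  shows "\<exists>N. \<forall>R>N. \<forall>K>N. q \<notin> path_image (mb_truncated c T p R +++ mb_detour c R (\<sigma> * K)) \<and>
    winding_number (mb_truncated c T p R +++ mb_detour c R (\<sigma> * K)) q = 0"
proof -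
  have T: "T > 0" using mb by (simp add: mb_contour_def)
  have "compact (path_image p)"
    using mb by (auto simp: mb_contour_def intro!: compact_path_image valid_path_imp_path)
  then obtain L where L: "\<And>s. s \<in> path_image p \<Longrightarrow> norm s \<le> L"
    by (meson bounded_iff compact_imp_bounded)
  have "\<forall>\<^sub>F x::real in at_top. connected_component (- mb_trace c T p) q (of_real (- \<sigma> * x))
      \<and> x > L \<and> x > \<bar>c\<bar> \<and> x > 0"
    by (intro eventually_conj conn eventually_gt_at_top)
  then obtain x where x: "connected_component (- mb_trace c T p) q (of_real (- \<sigma> * x))"
    "x > L" "x > \<bar>c\<bar>" "x > 0"
    by (auto dest!: eventually_happens simp: trivial_limit_at_top_linorder)
  have op: "open (- mb_trace c T p)"
    using closed_mb_trace[OF mb] by auto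
  then have "path_component (- mb_trace c T p) q (of_real (- \<sigma> * x))"
    using x(1) by (simp add: open_path_connected_component)
  then obtain g where g: "path g" "path_image g \<subseteq> - mb_trace c T p"
    "pathstart g = q" "pathfinish g = of_real (- \<sigma> * x)"
    unfolding path_component_def by blast
  have "compact (path_image g)" using g compact_path_image by blast
  then obtain N0 where N0: "\<And>s. s \<in> path_image g \<Longrightarrow> norm s \<le> N0"
    by (meson bounded_iff compact_imp_bounded)
  \<comment> \<open>Beyond \<open>N\<close> the detour misses the joining path \<open>g\<close>,
    whose points have norm at most \<open>N0\<close>, and it clears the height \<open>T\<close> and
    the abscissa \<open>c\<close>. For \<open>\<sigma> = 1\<close> the point is joined to the left
    end and the detour runs on the right; \<open>\<sigma> = - 1\<close> is the mirror image.\<close>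
  define N where "N = max (max N0 T) \<bar>c\<bar>"
  \<comment> \<open>A convex set containing the whole loop, with the far end
    \<open>- \<sigma> * x\<close> on its edge: \<open>x\<close> exceeds \<open>L\<close> and
    \<open>\<bar>c\<bar>\<close>, so neither \<open>p\<close> nor the vertical parts reach that
    far.\<close>
  define H where "H = {s. \<sigma> * Re s > - x}"
  have convH: "convex H"
  proof -
    have "H = {s. (\<sigma> *\<^sub>R 1) \<bullet> s > - x}" by (auto simp: H_def inner_complex_def)
    then show ?thesis by (simp only: convex_halfspace_gt)
  qed
  show ?thesis
  proof (intro exI[of _ N] allI impI)
    fix R K assume R: "R > N" and K: "K > N"
    let ?E = "mb_truncated c T p R +++ mb_detour c R (\<sigma> * K)"
    have RT: "T \<le> R" using R by (simp add: N_def)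
    have pim: "path_image ?E = path_image (mb_truncated c T p R) \<union> path_image (mb_detour c R (\<sigma> * K))"
      by (rule path_image_join) (simp add: mb_truncated_basics[OF mb] mb_detour_basics)
    have norm_gt: "norm s > N \<or> s \<in> mb_trace c T p" if "s \<in> path_image ?E" for s
    proof -
      have "s \<in> mb_trace c T p \<or> \<bar>Im s\<bar> = R \<or> \<bar>Re s\<bar> = K"
        using that path_image_mb_truncated(1)[OF mb RT] horizontal_segment(1)[of s]
          vertical_segment_Re[of s] \<sigma> R K T
        unfolding pim mb_detour_basics by (fastforce simp: N_def abs_mult)
      then show ?thesis
        using abs_Re_le_cmod[of s] abs_Im_le_cmod[of s] R K by auto
    qed
    have inH: "path_image ?E \<subseteq> H"
    proof
      fix s assume "s \<in> path_image ?E"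
      then have s: "s \<in> path_image p \<or> Re s = c \<or> Re s \<in> closed_segment c (\<sigma> * K)"
        using path_image_mb_truncated(2)[OF mb RT] horizontal_segment(2)[of s]
          vertical_segment_Re[of s] ends_in_segment(2)[of "\<sigma> * K" c]
        unfolding pim mb_detour_basics by (fastforce simp: closed_segment_commute)
      have "\<sigma> * Re s \<ge> - L" if "s \<in> path_image p"
        using L[OF that] abs_Re_le_cmod[of s] \<sigma> by auto
      moreover have "\<sigma> * Re s > - x" if "Re s \<in> closed_segment c (\<sigma> * K)"
        using that \<sigma> x K by (auto simp: closed_segment_eq_real_ivl N_def split: if_splits)
      ultimately show "s \<in> H" using s x \<sigma> by (auto simp: H_def)
    qed
    have vE: "valid_path ?E"
      by (rule valid_path_join) (simp_all add: mb_truncated_basics[OF mb] mb_detour_basics)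
    have loop: "pathfinish ?E = pathstart ?E"
      by (simp add: mb_truncated_basics[OF mb] mb_detour_basics)
    have disj: "path_image g \<inter> path_image ?E = {}"
      using norm_gt N0 g(2) by (force simp: N_def)
    have "winding_number ?E q = winding_number ?E (of_real (- \<sigma> * x))"
    proof (rule winding_number_eq[where S = "path_image g"])
      show "q \<in> path_image g" using g by (metis pathstart_in_path_image)
      show "of_real (- \<sigma> * x) \<in> path_image g" using g by (metis pathfinish_in_path_image)
    qed (use vE loop g disj in \<open>auto intro: valid_path_imp_path connected_path_image\<close>)
    also have "\<dots> = 0"
      by (rule winding_number_zero_outside[OF _ convH])
        (use vE loop inH \<sigma> in \<open>auto intro: valid_path_imp_path simp: H_def\<close>)
    finally show "q \<notin> path_image ?E \<and> winding_number ?E q = 0"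
      using disj g by (metis disjoint_iff pathstart_in_path_image)
  qed
qed

text \<open>The closed path through the three points stays in a horizontal line, a convex set that
  misses \<open>q\<close>, so its winding number is 0. No order of \<open>a\<close>,
  \<open>b\<close>, \<open>d\<close> is assumed, so it does not matter how \<open>c\<close>,
  \<open>c'\<close> and the far side \<open>K\<close> lie.\<close>

lemma winding_number_linepath_collinear:
  assumes "Im q \<noteq> R"
  shows "winding_number (linepath (Complex a R) (Complex b R)) q +
    winding_number (linepath (Complex b R) (Complex d R)) q =
    winding_number (linepath (Complex a R) (Complex d R)) q"
proof -
  have nq: "q \<notin> closed_segment (Complex x R) (Complex y R)" for x y
    using assms horizontal_segment(1) by blast
  define g where "g = linepath (Complex a R) (Complex b R) +++
    linepath (Complex b R) (Complex d R) +++ linepath (Complex d R) (Complex a R)"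
  have "winding_number g q = 0"
  proof (rule winding_number_zero_outside)
    show "path g" by (simp add: g_def)
    have "{s. Im s = R} = {s. \<i> \<bullet> s = R}" by (auto simp: inner_complex_def)
    then show "convex {s. Im s = R}" by (simp only: convex_hyperplane)
    show "path_image g \<subseteq> {s. Im s = R}"
      using horizontal_segment(1) by (auto simp: g_def path_image_join)
  qed (use assms in \<open>auto simp: g_def\<close>)
  moreover have "winding_number g q = winding_number (linepath (Complex a R) (Complex b R)) q +
    (winding_number (linepath (Complex b R) (Complex d R)) q +
     winding_number (linepath (Complex d R) (Complex a R)) q)"
    unfolding g_def by (subst winding_number_join; simp add: nq path_image_join)+
  moreover have "winding_number (linepath (Complex d R) (Complex a R)) q =
      - winding_number (linepath (Complex a R) (Complex d R)) q"
    using winding_number_reversepath[of "linepath (Complex a R) (Complex d R)" q] nq by simp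
  ultimately show ?thesis by (simp add: add_diff_eq)
qed

definition mb_difference ::
    "real \<Rightarrow> (real \<Rightarrow> complex) \<Rightarrow> real \<Rightarrow> (real \<Rightarrow> complex) \<Rightarrow> real \<Rightarrow> real \<Rightarrow> complex" where
  "mb_difference c g c' g' R =
     g +++ linepath (Complex c R) (Complex c' R) +++
     reversepath g' +++ linepath (Complex c' (- R)) (Complex c (- R))"

text \<open>The loop is, up to homology, the difference of the two detour loops: the common side at
  abscissa \<open>K\<close> cancels and the horizontal pieces combine by collinearity. Nothing has
  to be known about how \<open>g\<close> and \<open>g'\<close> cross each other.\<close>

lemma winding_number_mb_difference:
  fixes c c' R K :: real and g g' :: "real \<Rightarrow> complex"
  assumes g: "path g" "pathstart g = Complex c (- R)" "pathfinish g = Complex c R"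
    and g': "path g'" "pathstart g' = Complex c' (- R)" "pathfinish g' = Complex c' R"
    and q: "Im q = 0" "R > 0"
    and nq: "q \<notin> path_image (g +++ mb_detour c R K)" "q \<notin> path_image (g' +++ mb_detour c' R K)"
    and w: "winding_number (g +++ mb_detour c R K) q = 0" 
      "winding_number (g' +++ mb_detour c' R K) q = 0"
  shows "winding_number (mb_difference c g c' g' R) q = 0"
    and "q \<notin> path_image (mb_difference c g c' g' R)"
proof -
  have pd: "path (mb_detour x R K)" for x
    using mb_detour_basics(1) valid_path_imp_path by blast
  have nq': "q \<notin> path_image g" "q \<notin> path_image (mb_detour c R K)"
    "q \<notin> path_image g'" "q \<notin> path_image (mb_detour c' R K)"
    using nq g g' by (auto simp: path_image_join mb_detour_basics)
  have h: "q \<notin> closed_segment (Complex x R) (Complex y R)" 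
    "q \<notin> closed_segment (Complex x (-R)) (Complex y (-R))" for x y
    using q horizontal_segment(1) by force+
  have v: "q \<notin> closed_segment (Complex K R) (Complex K (- R))"
    using nq' by (auto simp: mb_detour_basics)
  have det: "winding_number (mb_detour x R K) q =
      winding_number (linepath (Complex x R) (Complex K R)) q +
      (winding_number (linepath (Complex K R) (Complex K (- R))) q +
       winding_number (linepath (Complex K (- R)) (Complex x (- R))) q)" for x
    unfolding mb_detour_def by (subst winding_number_join; simp add: h v path_image_join)+
  have "winding_number g q + winding_number (mb_detour c R K) q = 0"
    using w(1) by (subst (asm) winding_number_join) (use g pd nq' in \<open>auto simp: mb_detour_basics(2)\<close>)
  moreover have "winding_number g' q + winding_number (mb_detour c' R K) q = 0"
    using w(2) by (subst (asm) winding_number_join) (use g' pd nq' in \<open>auto simp: mb_detour_basics(2)\<close>)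
  moreover have "winding_number (mb_difference c g c' g' R) q = winding_number g q +
    (winding_number (linepath (Complex c R) (Complex c' R)) q +
    (winding_number (reversepath g') q +
     winding_number (linepath (Complex c' (- R)) (Complex c (- R))) q))"
    unfolding mb_difference_def
    by (subst winding_number_join; simp add: h nq' g g' path_image_join)+
  moreover have "winding_number (reversepath g') q = - winding_number g' q"
    using winding_number_reversepath g' nq' by blast
  moreover have "winding_number (linepath (Complex c R) (Complex c' R)) q +
    winding_number (linepath (Complex c' R) (Complex K R)) q =
    winding_number (linepath (Complex c R) (Complex K R)) q"
    using q by (intro winding_number_linepath_collinear) auto
  moreover have "winding_number (linepath (Complex K (- R)) (Complex c' (- R))) q +
    winding_number (linepath (Complex c' (- R)) (Complex c (- R))) q =
    winding_number (linepath (Complex K (- R)) (Complex c (- R))) q"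
    using q by (intro winding_number_linepath_collinear) auto
  ultimately show "winding_number (mb_difference c g c' g' R) q = 0"
    unfolding det by algebra
  show "q \<notin> path_image (mb_difference c g c' g' R)"
    using nq' h g g' by (simp add: mb_difference_def path_image_join)
qed

text \<open>
  Only finitely many of the poles lie in the vertical strip swept out by both contours, so a single
  truncation height serves all of them.
\<close>

lemma mb_truncated_difference_tendsto_0:
  assumes mb: "mb_contour c T p" "mb_contour c' T' p'"
    and hol: "f holomorphic_on - (Q \<union> Q')" and real: "\<And>q. q \<in> Q \<union> Q' \<Longrightarrow> Im q = 0"
    and fin: "\<And>a b. finite {q \<in> Q \<union> Q'. a < Re q \<and> Re q < b}"
    and left: "\<And>q. q \<in> Q \<Longrightarrow> left_of_contour q c T p" "\<And>q. q \<in> Q \<Longrightarrow> left_of_contour q c' T' p'"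
    and right: "\<And>q. q \<in> Q' \<Longrightarrow> right_of_contour q c T p" "\<And>q. q \<in> Q' \<Longrightarrow> right_of_contour q c' T' p'"
    and decay: "\<And>a b. \<exists>K. \<forall>s. a \<le> Re s \<longrightarrow> Re s \<le> b \<longrightarrow> 1 \<le> \<bar>Im s\<bar> \<longrightarrow> norm (f s) \<le> K / (Im s)\<^sup>2"
  shows "((\<lambda>R. contour_integral (mb_truncated c T p R) f -
    contour_integral (mb_truncated c' T' p' R) f) \<longlongrightarrow> 0) at_top"
proof -
  let ?g = "mb_truncated c T p" and ?g' = "mb_truncated c' T' p'"
  let ?D = "\<lambda>R. mb_difference c (?g R) c' (?g' R) R"
  have "compact (path_image p \<union> path_image p')"
    using mb by (auto simp: mb_contour_def intro!: compact_Un compact_path_image valid_path_imp_path)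
  then obtain L where L: "\<And>s. s \<in> path_image p \<union> path_image p' \<Longrightarrow> norm s \<le> L"
    by (meson bounded_iff compact_imp_bounded)
  \<comment> \<open>The strip \<open>\<bar>Re s\<bar> < b\<close> contains both contours and the
    horizontal segments that connect them, so only the poles in \<open>F\<close> matter.\<close>
  define b where "b = max (max \<bar>c\<bar> \<bar>c'\<bar>) \<bar>L\<bar> + 1"
  define V where "V = {s. - b < Re s \<and> Re s < b}"
  define F where "F = {q \<in> Q \<union> Q'. - b < Re q \<and> Re q < b}"
  have "finite F" unfolding F_def by (rule fin)
  have convV: "convex V" and openV: "open V"
  proof -
    have "V = {s. 1 \<bullet> s > - b} \<inter> {s. 1 \<bullet> s < b}"
      by (auto simp: V_def inner_complex_def)
    then show "convex V" "open V"
      by (simp_all only: convex_Int convex_halfspace_gt convex_halfspace_lt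
          open_Int open_halfspace_gt open_halfspace_lt)
  qed
  note basics = mb_truncated_basics[OF mb(1)] mb_truncated_basics[OF mb(2)]
  have vpD: "valid_path (?D R)" for R
    unfolding mb_difference_def
    by (intro valid_path_join valid_path_linepath) (auto simp: basics)
  have loopD: "pathfinish (?D R) = pathstart (?D R)" for R
    by (simp add: mb_difference_def basics)
  have imD: "path_image (?D R) = path_image (?g R) \<union> closed_segment (Complex c R) (Complex c' R) \<union>
      path_image (?g' R) \<union> closed_segment (Complex c' (- R)) (Complex c (- R))" for R
    by (simp add: mb_difference_def path_image_join basics Un_assoc)
  have segV: "x \<in> {-b<..<b}" if "x \<in> closed_segment c c' \<or> x \<in> closed_segment c' c" for x
    using that by (auto simp: closed_segment_eq_real_ivl b_def split: if_splits)
  have DV: "path_image (?D R) \<subseteq> V" if R: "R \<ge> T" "R \<ge> T'" for R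
  proof
    fix s assume "s \<in> path_image (?D R)"
    then consider "s \<in> path_image p \<union> path_image p'" | "Re s = c" | "Re s = c'"
      | "Re s \<in> closed_segment c c'" | "Re s \<in> closed_segment c' c"
      unfolding imD
      using path_image_mb_truncated(2)[OF mb(1) R(1)] path_image_mb_truncated(2)[OF mb(2) R(2)]
        horizontal_segment(2) by blast
    then show "s \<in> V"
    proof cases
      case 1
      then show ?thesis using L[OF 1] abs_Re_le_cmod[of s] by (auto simp: V_def b_def)
    qed (use segV in \<open>auto simp: V_def b_def\<close>)
  qed
  have pole: "\<forall>\<^sub>F R in at_top. winding_number (?D R) q = 0 \<and> q \<notin> path_image (?D R)" if "q \<in> F" for q
  proof -
    \<comment> \<open>Here separation enters: both contours have the pole on the same side, so one
      sign serves both and their detours share the far side.\<close>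
    have "\<exists>\<sigma>\<in>{1,-1::real}. (\<forall>\<^sub>F x::real in at_top. connected_component (- mb_trace c T p) q (of_real (- \<sigma> * x))) \<and>
       (\<forall>\<^sub>F x::real in at_top. connected_component (- mb_trace c' T' p') q (of_real (- \<sigma> * x)))"
      using \<open>q \<in> F\<close> left[of q] right[of q]
      unfolding F_def left_of_contour_def right_of_contour_def by auto
    then obtain \<sigma> :: real where \<sigma>: "\<sigma> \<in> {1, -1}"
      "\<forall>\<^sub>F x::real in at_top. connected_component (- mb_trace c T p) q (of_real (- \<sigma> * x))"
      "\<forall>\<^sub>F x::real in at_top. connected_component (- mb_trace c' T' p') q (of_real (- \<sigma> * x))"
      by blast
    obtain N where N: "\<And>R K. R > N \<Longrightarrow> K > N \<Longrightarrow> q \<notin> path_image (?g R +++ mb_detour c R (\<sigma> * K)) \<and>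
        winding_number (?g R +++ mb_detour c R (\<sigma> * K)) q = 0"
      using winding_number_mb_detour_eq_0[OF mb(1) \<sigma>(1,2)] by blast
    obtain N' where N': "\<And>R K. R > N' \<Longrightarrow> K > N' \<Longrightarrow> q \<notin> path_image (?g' R +++ mb_detour c' R (\<sigma> * K)) \<and>
        winding_number (?g' R +++ mb_detour c' R (\<sigma> * K)) q = 0"
      using winding_number_mb_detour_eq_0[OF mb(2) \<sigma>(1,3)] by blast
    show ?thesis
      using eventually_gt_at_top[of "max (max N N') 0"]
    proof eventually_elim
      case (elim R)
      have "winding_number (?D R) q = 0" "q \<notin> path_image (?D R)"
        by (rule winding_number_mb_difference[where K = "\<sigma> * (max N N' + 1)"];
            use N[of R "max N N' + 1"] N'[of R "max N N' + 1"] elim real[of q] \<open>q \<in> F\<close> basics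
            in \<open>simp add: F_def valid_path_imp_path\<close>)+
      then show ?case by blast
    qed
  qed
  have poles: "\<forall>\<^sub>F R in at_top. \<forall>q\<in>F. winding_number (?D R) q = 0 \<and> q \<notin> path_image (?D R)"
    using pole \<open>finite F\<close> by (simp add: eventually_ball_finite)
  obtain K0 where K0: "\<And>s. - b \<le> Re s \<Longrightarrow> Re s \<le> b \<Longrightarrow> 1 \<le> \<bar>Im s\<bar> \<Longrightarrow> norm (f s) \<le> K0 / (Im s)\<^sup>2"
    using decay by blast
  define K where "K = max K0 0"
  have K: "norm (f s) \<le> K / (Im s)\<^sup>2" if "s \<in> V" "1 \<le> \<bar>Im s\<bar>" for s
  proof -
    have "norm (f s) \<le> K0 / (Im s)\<^sup>2" using that K0[of s] by (auto simp: V_def)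
    also have "\<dots> \<le> K / (Im s)\<^sup>2" by (intro divide_right_mono) (auto simp: K_def)
    finally show ?thesis .
  qed
  have K_nonneg: "K \<ge> 0" by (simp add: K_def)
  \<comment> \<open>By Cauchy's theorem the difference equals minus the integrals over the two
    horizontal connectors. Each has length \<open>\<bar>c - c'\<bar>\<close> and lies at height
    \<open>R\<close> or \<open>- R\<close>, where the integrand is at most
    \<open>K / R\<^sup>2\<close>.\<close>
  have bound: "\<forall>\<^sub>F R in at_top. norm (contour_integral (?g R) f - contour_integral (?g' R) f)
      \<le> 2 * (K / R\<^sup>2 * \<bar>c - c'\<bar>)"
    using poles eventually_ge_at_top[of "max (max T T') 1"]
  proof eventually_elim
    case (elim R)
    have R: "R \<ge> T" "R \<ge> T'" "R \<ge> 1" using elim by auto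
    have opS: "open (V - F)" using openV \<open>finite F\<close> by (simp add: finite_imp_closed open_Diff)
    have holS: "f holomorphic_on V - F"
      by (rule holomorphic_on_subset[OF hol]) (auto simp: V_def F_def)
    have sub: "path_image (?D R) \<subseteq> V - F" using DV[OF R(1,2)] elim by blast
    have "(f has_contour_integral 0) (?D R)"
    proof (rule Cauchy_theorem_global[OF opS holS vpD loopD sub])
      fix w assume "w \<notin> V - F"
      then consider "w \<notin> V" | "w \<in> F" by blast
      then show "winding_number (?D R) w = 0"
      proof cases
        case 1
        then show ?thesis
          using winding_number_zero_outside[OF _ convV loopD 1 DV[OF R(1,2)]] vpD
          by (simp add: valid_path_imp_path)
      qed (use elim in blast)
    qed
    then have 0: "contour_integral (?D R) f = 0" by (rule contour_integral_unique)
    have subs: "path_image (?g R) \<subseteq> V - F" "path_image (?g' R) \<subseteq> V - F"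
      "closed_segment (Complex c R) (Complex c' R) \<subseteq> V - F"
      "closed_segment (Complex c' (- R)) (Complex c (- R)) \<subseteq> V - F"
      using sub unfolding imD by blast+
    have int: "f contour_integrable_on ?g R" "f contour_integrable_on ?g' R"
      "f contour_integrable_on linepath (Complex c R) (Complex c' R)"
      "f contour_integrable_on linepath (Complex c' (- R)) (Complex c (- R))"
      using subs by (auto intro!: contour_integrable_holomorphic_simple[OF holS opS] simp: basics)
    have "contour_integral (?D R) f = contour_integral (?g R) f +
        (contour_integral (linepath (Complex c R) (Complex c' R)) f +
        (- contour_integral (?g' R) f +
         contour_integral (linepath (Complex c' (- R)) (Complex c (- R))) f))"
      unfolding mb_difference_def using int basics
      by (simp add: contour_integrable_reversepath contour_integral_reversepath)
    then have eq: "contour_integral (?g R) f - contour_integral (?g' R) f =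
        - (contour_integral (linepath (Complex c R) (Complex c' R)) f +
           contour_integral (linepath (Complex c' (- R)) (Complex c (- R))) f)"
      using 0 by (simp add: algebra_simps add_eq_0_iff)
    have le: "norm (f s) \<le> K / R\<^sup>2" if "s \<in> V - F" "\<bar>Im s\<bar> = R" for s
      using K[of s] that R by (metis DiffD1 power2_abs)
    have top: "norm (contour_integral (linepath (Complex c R) (Complex c' R)) f)
        \<le> K / R\<^sup>2 * norm (Complex c' R - Complex c R)"
    proof (rule contour_integral_bound_linepath[OF int(3)])
      show "norm (f s) \<le> K / R\<^sup>2" if "s \<in> closed_segment (Complex c R) (Complex c' R)" for s
        using that subs(3) horizontal_segment(1)[OF that] R by (intro le) auto
    qed (use K_nonneg in simp)
    have bottom: "norm (contour_integral (linepath (Complex c' (- R)) (Complex c (- R))) f)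
        \<le> K / R\<^sup>2 * norm (Complex c (- R) - Complex c' (- R))"
    proof (rule contour_integral_bound_linepath[OF int(4)])
      show "norm (f s) \<le> K / R\<^sup>2" if "s \<in> closed_segment (Complex c' (- R)) (Complex c (- R))" for s
        using that subs(4) horizontal_segment(1)[OF that] R by (intro le) auto
    qed (use K_nonneg in simp)
    have "norm (Complex c' R - Complex c R) = \<bar>c - c'\<bar>"
      "norm (Complex c (- R) - Complex c' (- R)) = \<bar>c - c'\<bar>"
      by (simp_all add: complex_diff cmod_def)
    then show ?case
      unfolding eq norm_minus_cancel using top bottom
      by (intro order.trans[OF norm_triangle_ineq]) simp
  qed
  have "((\<lambda>R. 2 * (K / R\<^sup>2 * \<bar>c - c'\<bar>)) \<longlongrightarrow> 0) at_top"
    by real_asymp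
  then show ?thesis
    by (rule Lim_null_comparison[OF bound])
qed

section \<open>Vertical lines as contours\<close>

definition straight :: "real \<Rightarrow> real \<Rightarrow> complex" where
  "straight c = linepath (Complex c (- 1)) (Complex c 1)"

lemma mb_contour_straight: "mb_contour c 1 (straight c)"
  by (simp add: mb_contour_def straight_def)

lemma mb_trace_straight: "mb_trace c 1 (straight c) \<subseteq> {s. Re s = c}"
  using vertical_segment_Re by (auto simp: mb_trace_def straight_def)

lemma left_of_straight:
  assumes "Re q < c"
  shows "left_of_contour q c 1 (straight c)"
  unfolding left_of_contour_def using eventually_gt_at_top[of "- c"]
proof eventually_elim
  case (elim x)
  have "{s. Re s < c} = {s. 1 \<bullet> s < c}" by (auto simp: inner_complex_def)
  then have "convex {s. Re s < c}" by (simp only: convex_halfspace_lt)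
  then show ?case
    by (intro connected_componentI[of "{s. Re s < c}"] convex_connected)
      (use mb_trace_straight[of c] assms elim in auto)
qed

lemma right_of_straight:
  assumes "Re q > c"
  shows "right_of_contour q c 1 (straight c)"
  unfolding right_of_contour_def using eventually_gt_at_top[of c]
proof eventually_elim
  case (elim x)
  have "{s. Re s > c} = {s. 1 \<bullet> s > c}" by (auto simp: inner_complex_def)
  then have "convex {s. Re s > c}" by (simp only: convex_halfspace_gt)
  then show ?case
    by (intro connected_componentI[of "{s. Re s > c}"] convex_connected)
      (use mb_trace_straight[of c] assms elim in auto)
qed

lemma contour_integral_mb_truncated_straight:
  assumes R: "R > 1" and cont: "continuous_on UNIV (\<lambda>y. f (Complex c y))"
  shows "contour_integral (mb_truncated c 1 (straight c) R) f =
    \<i> * integral {- R..R} (\<lambda>y. f (Complex c y))"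
proof -
  have int: "(\<lambda>y. f (Complex c y)) integrable_on {a..b}" for a b
    by (intro integrable_continuous_real continuous_on_subset[OF cont]) auto
  have "f contour_integrable_on linepath (Complex c a) (Complex c b)" if "a < b" for a b
    unfolding contour_integrable_on_def
    by (rule exI[of _ "\<i> * integral {a..b} (\<lambda>y. f (Complex c y))"])
      (use that int in \<open>simp add: has_contour_integral_linepath_same_Re_iff[of _ c _ a b] has_integral_integral\<close>)
  note ci = this[of "-R" "-1"] this[of "-1" 1] this[of 1 R]
  have "contour_integral (mb_truncated c 1 (straight c) R) f =
     contour_integral (linepath (Complex c (- R)) (Complex c (- 1))) f +
     (contour_integral (linepath (Complex c (- 1)) (Complex c 1)) f +
      contour_integral (linepath (Complex c 1) (Complex c R)) f)"
    unfolding mb_truncated_def straight_def using ci R by simp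
  also have "\<dots> = \<i> * (integral {-R..-1} (\<lambda>y. f (Complex c y)) +
     (integral {-1..1} (\<lambda>y. f (Complex c y)) + integral {1..R} (\<lambda>y. f (Complex c y))))"
    using R by (simp add: contour_integral_linepath_same_Re[of _ c] distrib_left)
  also have "integral {-1..1} (\<lambda>y. f (Complex c y)) + integral {1..R} (\<lambda>y. f (Complex c y)) =
      integral {-1..R} (\<lambda>y. f (Complex c y))"
    by (rule Henstock_Kurzweil_Integration.integral_combine) (use R int in auto)
  also have "integral {-R..-1} (\<lambda>y. f (Complex c y)) + integral {-1..R} (\<lambda>y. f (Complex c y)) =
      integral {-R..R} (\<lambda>y. f (Complex c y))"
    by (rule Henstock_Kurzweil_Integration.integral_combine) (use R int in auto)
  finally show ?thesis .
qed

text \<open>Turns the symmetric limit in the definition of \<open>meijer_G\<close> into a Lebesgue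
  integral, to which Fubini's theorem applies later.\<close>

lemma tendsto_integral_symmetric:
  fixes g :: "real \<Rightarrow> complex"
  assumes g: "integrable lborel g"
  shows "((\<lambda>R. integral {- R..R} g) \<longlongrightarrow> (\<integral>y. g y \<partial>lborel)) at_top"
proof -
  have "((\<lambda>R. \<integral>y. indicator {-R..R} y *\<^sub>R g y \<partial>lborel) \<longlongrightarrow> (\<integral>y. g y \<partial>lborel)) at_top"
  proof (rule integral_dominated_convergence_at_top[where w = "\<lambda>y. norm (g y)"])
    show "AE y in lborel. ((\<lambda>R. indicator {-R..R} y *\<^sub>R g y) \<longlongrightarrow> g y) at_top"
    proof (rule AE_I2)
      fix y :: real
      have "\<forall>\<^sub>F R in at_top. indicator {-R..R} y *\<^sub>R g y = g y"
        using eventually_ge_at_top[of "\<bar>y\<bar>"] by eventually_elim (auto simp: indicator_def abs_le_iff)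
      then show "((\<lambda>R. indicator {-R..R} y *\<^sub>R g y) \<longlongrightarrow> g y) at_top"
        by (rule tendsto_eventually)
    qed
    show "integrable lborel (\<lambda>y. norm (g y))" using g by simp
  qed (use g in \<open>auto simp: indicator_def\<close>)
  moreover have "integral {-R..R} g = (\<integral>y. indicator {-R..R} y *\<^sub>R g y \<partial>lborel)" for R
  proof -
    have "set_integrable lborel {-R..R} g"
      unfolding set_integrable_def using g by (rule integrable_mult_indicator[rotated]) auto
    from set_borel_integral_eq_integral(2)[OF this] show ?thesis
      by (simp add: set_lebesgue_integral_def)
  qed
  ultimately show ?thesis by simp
qed

lemma integrable_line_decay:
  fixes g :: "real \<Rightarrow> complex"
  assumes cont: "continuous_on UNIV g" and K: "\<And>y. 1 \<le> \<bar>y\<bar> \<Longrightarrow> norm (g y) \<le> K / y\<^sup>2"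
  shows "integrable lborel g"
proof -
  have "compact (g ` {-1..1})"
    by (intro compact_continuous_image continuous_on_subset[OF cont]) auto
  then obtain B where B: "\<And>y. y \<in> {-1..1} \<Longrightarrow> norm (g y) \<le> B"
    by (meson bounded_iff compact_imp_bounded imageI)
  \<comment> \<open>\<open>C\<close> dominates both bounds. The factor 2 below comes from
    \<open>1 + y\<^sup>2 \<le> 2\<close> on the inner interval and from
    \<open>1 + y\<^sup>2 \<le> 2 * y\<^sup>2\<close> outside it.\<close>
  define C where "C = \<bar>B\<bar> + \<bar>K\<bar>"
  have *: "integrable lborel (\<lambda>y::real. 2 * C * inverse (1 + y\<^sup>2))"
    using integrable_inverse_1_plus_square
    by (intro integrable_mult_right) (simp add: set_integrable_def einterval_def)
  have "norm (g y) \<le> 2 * C * inverse (1 + y\<^sup>2)" for y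
  proof (cases "\<bar>y\<bar> \<le> 1")
    case True
    then have "norm (g y) \<le> B" by (intro B) auto
    then have "norm (g y) \<le> C" by (simp add: C_def)
    moreover have "1 \<le> 2 * inverse (1 + y\<^sup>2)"
      using True by (simp add: field_simps add_pos_nonneg power2_le_iff_abs_le abs_square_le_1)
    then have "C * 1 \<le> C * (2 * inverse (1 + y\<^sup>2))"
      by (intro mult_left_mono) (auto simp: C_def)
    ultimately show ?thesis by (simp add: mult_ac)
  next
    case False
    then have y: "y\<^sup>2 \<ge> 1" by (metis abs_square_less_1 linorder_not_less nle_le)
    have "norm (g y) \<le> K / y\<^sup>2" using False by (intro K) auto
    also have "\<dots> \<le> C * inverse (y\<^sup>2)"
      by (simp add: divide_inverse mult_right_mono C_def)
    also have "\<dots> \<le> C * (2 * inverse (1 + y\<^sup>2))"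
      using y order.strict_trans2[OF zero_less_one y]
      by (intro mult_left_mono) (auto simp: field_simps C_def)
    finally show ?thesis by (simp add: mult_ac)
  qed
  then show ?thesis
    using borel_measurable_continuous_onI[OF cont]
    by (intro Bochner_Integration.integrable_bound[OF *]) (auto intro: order.trans[OF _ abs_ge_self])
qed

section \<open>Meijer functions as line integrals\<close>

lemma finite_arithmetic_in_strip:
  fixes u v :: real
  shows "finite {k::nat. u < of_nat k + v \<and> of_nat k + v < w}"
proof (rule finite_subset)
  show "{k::nat. u < of_nat k + v \<and> of_nat k + v < w} \<subseteq> {..nat \<lceil>w - v\<rceil>}"
  proof
    fix k assume "k \<in> {k::nat. u < of_nat k + v \<and> of_nat k + v < w}"
    then have "real k < w - v" by auto
    then show "k \<in> {..nat \<lceil>w - v\<rceil>}" by simp linarith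
  qed
qed simp

text \<open>With the denominators written through the entire function \<open>rGamma\<close> and the
  power as \<open>exp (- s * Ln z)\<close>, only the Gamma factors of the numerator have
  singularities. Nothing is claimed at a numerator pole that a denominator happens to
  cancel.\<close>

lemma meijer_integrand_holomorphic:
  assumes "z \<noteq> 0"
  shows "meijer_integrand m n as bs z holomorphic_on
    - ((\<Union>j<m. range (\<lambda>k. - (bs ! j) - of_nat k)) \<union> (\<Union>j<n. range (\<lambda>k. 1 - as ! j + of_nat k)))"
    (is "_ holomorphic_on - (?Q \<union> ?Q')")
proof -
  have 1: "bs ! j + s \<notin> \<int>\<^sub>\<le>\<^sub>0" if "s \<notin> ?Q" "j < m" for s j
  proof
    assume "bs ! j + s \<in> \<int>\<^sub>\<le>\<^sub>0"
    then obtain k where "bs ! j + s = - of_nat k" by (elim nonpos_Ints_cases')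
    then have "s = - (bs ! j) - of_nat k" by (simp add: algebra_simps eq_neg_iff_add_eq_0)
    then show False using that by blast
  qed
  have 2: "1 - as ! j - s \<notin> \<int>\<^sub>\<le>\<^sub>0" if "s \<notin> ?Q'" "j < n" for s j
  proof
    assume "1 - as ! j - s \<in> \<int>\<^sub>\<le>\<^sub>0"
    then obtain k where "1 - as ! j - s = - of_nat k" by (elim nonpos_Ints_cases')
    then have "s = 1 - as ! j + of_nat k" by (simp add: algebra_simps)
    then show False using that by blast
  qed
  have "(\<lambda>s. Gamma (bs ! j + s)) holomorphic_on - (?Q \<union> ?Q')" if "j < m" for j
    by (rule holomorphic_Gamma', intro holomorphic_intros, rule 1[OF _ that]) blast
  moreover have "(\<lambda>s. Gamma (1 - as ! j - s)) holomorphic_on - (?Q \<union> ?Q')" if "j < n" for j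
    by (rule holomorphic_Gamma', intro holomorphic_intros, rule 2[OF _ that]) blast
  ultimately have "(\<lambda>s. ((\<Prod>j<m. Gamma (bs ! j + s)) * (\<Prod>j<n. Gamma (1 - as ! j - s))) *
     ((\<Prod>j=m..<length bs. rGamma (1 - bs ! j - s)) * (\<Prod>j=n..<length as. rGamma (as ! j + s)))
     * exp (- s * Ln z)) holomorphic_on - (?Q \<union> ?Q')"
    by (intro holomorphic_on_mult holomorphic_on_prod holomorphic_rGamma' holomorphic_on_exp
        holomorphic_on_add holomorphic_on_diff holomorphic_on_minus holomorphic_on_ident
        holomorphic_on_const holomorphic_on_compose_gen[of _ _ exp, unfolded o_def])
      auto
  moreover have "meijer_integrand m n as bs z = (\<lambda>s. ((\<Prod>j<m. Gamma (bs ! j + s)) * (\<Prod>j<n. Gamma (1 - as ! j - s))) *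
     ((\<Prod>j=m..<length bs. rGamma (1 - bs ! j - s)) * (\<Prod>j=n..<length as. rGamma (as ! j + s)))
     * exp (- s * Ln z))"
    using assms
    by (simp add: fun_eq_iff meijer_integrand_def rGamma_inverse_Gamma divide_inverse prod_inversef[unfolded o_def]
        powr_def mult_ac)
  ultimately show ?thesis by simp
qed

text \<open>The inequalities on \<open>c\<close> say that the vertical line itself separates the
  poles. The line is thus a witness for the description, and comparing it with every other
  admissible contour gives uniqueness.\<close>

theorem meijer_G_eq_line_integral:
  fixes as bs :: "real list" and z :: complex and m n :: nat
  defines "f \<equiv> meijer_integrand m n (map of_real as) (map of_real bs) z"
  assumes z: "z \<noteq> 0" and mn: "m \<le> length bs" "n \<le> length as"
    and c: "\<And>j. j < m \<Longrightarrow> - (bs ! j) < c" "\<And>j. j < n \<Longrightarrow> c < 1 - as ! j"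
    and decay: "\<And>a b. \<exists>K. \<forall>s. a \<le> Re s \<longrightarrow> Re s \<le> b \<longrightarrow> 1 \<le> \<bar>Im s\<bar> \<longrightarrow> norm (f s) \<le> K / (Im s)\<^sup>2"
  shows "integrable lborel (\<lambda>y. f (Complex c y))"
    and "meijer_G m n (map of_real as) (map of_real bs) z = (\<integral>y. f (Complex c y) \<partial>lborel) / (2 * of_real pi)"
proof -
  let ?as = "map complex_of_real as" and ?bs = "map complex_of_real bs"
  define Q where "Q = (\<Union>j<m. range (\<lambda>k. - (?bs ! j) - of_nat k))"
  define Q' where "Q' = (\<Union>j<n. range (\<lambda>k. 1 - ?as ! j + of_nat k))"
  have hol: "f holomorphic_on - (Q \<union> Q')"
    unfolding f_def Q_def Q'_def by (rule meijer_integrand_holomorphic[OF z])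
  have Qc: "Re q < c" "Im q = 0" if "q \<in> Q" for q
    using that c(1) mn by (fastforce simp: Q_def)+
  have Q'c: "Re q > c" "Im q = 0" if "q \<in> Q'" for q
    using that c(2) mn by (fastforce simp: Q'_def)+
  have fin: "finite {q \<in> Q \<union> Q'. a < Re q \<and> Re q < b}" for a b
  proof (rule finite_subset)
    show "{q \<in> Q \<union> Q'. a < Re q \<and> Re q < b} \<subseteq>
      (\<Union>j<m. (\<lambda>k. - (?bs ! j) - of_nat k) ` {k. - b < of_nat k + bs ! j \<and> of_nat k + bs ! j < - a}) \<union>
      (\<Union>j<n. (\<lambda>k. 1 - ?as ! j + of_nat k) ` {k. a < of_nat k + (1 - as ! j) \<and> of_nat k + (1 - as ! j) < b})"
      using mn unfolding Q_def Q'_def by (fastforce simp: image_iff)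
  qed (use finite_arithmetic_in_strip in blast)
  have "continuous_on {s. Re s = c} f"
    by (rule holomorphic_on_imp_continuous_on[OF holomorphic_on_subset[OF hol]])
      (use Qc Q'c in fastforce)
  then have cont: "continuous_on UNIV (\<lambda>y. f (Complex c y))"
    by (rule continuous_on_compose2) (auto intro!: continuous_intros simp: Complex_eq)
  obtain K where "\<forall>s. c \<le> Re s \<longrightarrow> Re s \<le> c \<longrightarrow> 1 \<le> \<bar>Im s\<bar> \<longrightarrow> norm (f s) \<le> K / (Im s)\<^sup>2"
    using decay by blast
  then have K: "norm (f (Complex c y)) \<le> K / y\<^sup>2" if "1 \<le> \<bar>y\<bar>" for y
    using that by (auto dest!: spec[of _ "Complex c y"])
  show int: "integrable lborel (\<lambda>y. f (Complex c y))"
    using cont K by (rule integrable_line_decay)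
  let ?J = "\<integral>y. f (Complex c y) \<partial>lborel"
  have "((\<lambda>R. \<i> * integral {- R..R} (\<lambda>y. f (Complex c y))) \<longlongrightarrow> \<i> * ?J) at_top"
    by (intro tendsto_intros tendsto_integral_symmetric int)
  moreover have "\<forall>\<^sub>F R in at_top. \<i> * integral {- R..R} (\<lambda>y. f (Complex c y)) =
      contour_integral (mb_truncated c 1 (straight c) R) f"
    using eventually_gt_at_top[of 1]
    by eventually_elim (simp add: contour_integral_mb_truncated_straight[OF _ cont])
  ultimately have str: "((\<lambda>R. contour_integral (mb_truncated c 1 (straight c) R) f) \<longlongrightarrow> \<i> * ?J) at_top"
    by (rule Lim_transform_eventually)
  let ?v = "?J / (2 * of_real pi)"
  have v: "\<i> * ?J / (2 * of_real pi * \<i>) = ?v" by (simp add: field_simps)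
  have ex: "meijer_contour m n ?as ?bs c 1 (straight c)"
    unfolding meijer_contour_def
  proof (intro conjI allI impI left_of_straight right_of_straight mb_contour_straight)
    show "Re (- (?bs ! j) - of_nat k) < c" if "j < m" for j k
      using that by (intro Qc) (unfold Q_def, blast)
    show "Re (1 - ?as ! j + of_nat k) > c" if "j < n" for j k
      using that by (intro Q'c) (unfold Q'_def, blast)
  qed
  have lim: "((\<lambda>R. contour_integral (mb_truncated c' T p R) f / (2 * of_real pi * \<i>)) \<longlongrightarrow> ?v) at_top"
    if mc: "meijer_contour m n ?as ?bs c' T p" for c' T p
  proof -
    have mb: "mb_contour c' T p" using mc by (simp add: meijer_contour_def)
    have l: "left_of_contour q c' T p" if "q \<in> Q" for q
      using mc that by (auto simp: meijer_contour_def Q_def)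
    have r: "right_of_contour q c' T p" if "q \<in> Q'" for q
      using mc that by (auto simp: meijer_contour_def Q'_def)
    have "((\<lambda>R. contour_integral (mb_truncated c' T p R) f -
        contour_integral (mb_truncated c 1 (straight c) R) f) \<longlongrightarrow> 0) at_top"
      by (rule mb_truncated_difference_tendsto_0[OF mb mb_contour_straight hol _ fin l _ r _ decay])
        (use Qc Q'c left_of_straight right_of_straight in auto)
    from tendsto_add[OF this str]
    have "((\<lambda>R. contour_integral (mb_truncated c' T p R) f) \<longlongrightarrow> \<i> * ?J) at_top" by simp
    then have "((\<lambda>R. contour_integral (mb_truncated c' T p R) f / (2 * of_real pi * \<i>))
        \<longlongrightarrow> \<i> * ?J / (2 * of_real pi * \<i>)) at_top"
      by (intro tendsto_intros) auto
    then show ?thesis unfolding v .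
  qed
  show "meijer_G m n ?as ?bs z = ?v"
    unfolding meijer_G_def
  proof (rule the_equality)
    show "\<exists>c T p. meijer_contour m n ?as ?bs c T p \<and>
        ((\<lambda>R. contour_integral (mb_truncated c T p R) (meijer_integrand m n ?as ?bs z)
           / (2 * of_real pi * \<i>)) \<longlongrightarrow> ?v) at_top"
      using ex lim[OF ex] unfolding f_def by blast
  next
    fix I assume "\<exists>c T p. meijer_contour m n ?as ?bs c T p \<and>
        ((\<lambda>R. contour_integral (mb_truncated c T p R) (meijer_integrand m n ?as ?bs z)
           / (2 * of_real pi * \<i>)) \<longlongrightarrow> I) at_top"
    then show "I = ?v"
      using lim tendsto_unique[OF trivial_limit_at_top_linorder] unfolding f_def by metis
  qed
qed

section \<open>Decay in vertical strips\<close>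

text \<open>In Euler's integral the modulus of \<open>t powr (s - 1)\<close> is
  \<open>t powr (Re s - 1)\<close>.\<close>

lemma norm_Gamma_complex_le:
  assumes "Re s > 0"
  shows "norm (Gamma s) \<le> Gamma (Re s)"
proof -
  let ?f = "\<lambda>t::real. of_real t powr (s - 1) / of_real (exp t)"
  have f: "(?f has_integral Gamma s) {0..}" by (rule Gamma_integral_complex[OF assms])
  have g: "((\<lambda>t. t powr (Re s - 1) / exp t) has_integral Gamma (Re s)) {0..}"
    by (rule Gamma_integral_real[OF assms])
  have "norm (integral {0..} ?f) \<le> integral {0..} (\<lambda>t. t powr (Re s - 1) / exp t)"
    by (rule integral_norm_bound_integral)
      (use f g in \<open>auto simp: norm_divide norm_powr_real_powr intro: has_integral_integrable\<close>)
  then show ?thesis using f g by (simp add: integral_unique)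
qed

text \<open>The condition \<open>1 \<le> \<bar>Im s\<bar>\<close> keeps clear of the poles, which
  are real for all functions used here. Exponents add under products, so one factor may supply the
  decay while the others are merely bounded (\<open>N = 0\<close>).\<close>

definition strip_decay :: "nat \<Rightarrow> (complex \<Rightarrow> complex) \<Rightarrow> bool" where
  "strip_decay N f \<longleftrightarrow> (\<forall>a b. \<exists>K. \<forall>s. a \<le> Re s \<longrightarrow> Re s \<le> b \<longrightarrow> 1 \<le> \<bar>Im s\<bar> \<longrightarrow>
     norm (f s) \<le> K / \<bar>Im s\<bar> ^ N)"

lemma strip_decayE:
  assumes "strip_decay N f"
  obtains K where "K \<ge> 0"
    "\<And>s. a \<le> Re s \<Longrightarrow> Re s \<le> b \<Longrightarrow> 1 \<le> \<bar>Im s\<bar> \<Longrightarrow> norm (f s) \<le> K / \<bar>Im s\<bar> ^ N"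
proof -
  obtain K where K: "\<And>s. a \<le> Re s \<Longrightarrow> Re s \<le> b \<Longrightarrow> 1 \<le> \<bar>Im s\<bar> \<Longrightarrow> norm (f s) \<le> K / \<bar>Im s\<bar> ^ N"
    using assms unfolding strip_decay_def by blast
  have "norm (f s) \<le> \<bar>K\<bar> / \<bar>Im s\<bar> ^ N" if "a \<le> Re s" "Re s \<le> b" "1 \<le> \<bar>Im s\<bar>" for s
    using K[OF that] by (rule order.trans) (intro divide_right_mono, auto)
  then show ?thesis using that[of "\<bar>K\<bar>"] by simp
qed

lemma strip_decay_cong:
  assumes "strip_decay N f" "\<And>s. Im s \<noteq> 0 \<Longrightarrow> g s = f s"
  shows "strip_decay N g"
proof -
  have "1 \<le> \<bar>Im s\<bar> \<Longrightarrow> g s = f s" for s using assms(2)[of s] by auto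
  then show ?thesis using assms(1) unfolding strip_decay_def by simp
qed

lemma strip_decay_mult:
  assumes "strip_decay N f" "strip_decay M g"
  shows "strip_decay (N + M) (\<lambda>s. f s * g s)"
  unfolding strip_decay_def
proof (intro allI)
  fix a b
  obtain K where K: "K \<ge> 0" "\<And>s. a \<le> Re s \<Longrightarrow> Re s \<le> b \<Longrightarrow> 1 \<le> \<bar>Im s\<bar> \<Longrightarrow> norm (f s) \<le> K / \<bar>Im s\<bar> ^ N"
    using strip_decayE[OF assms(1), of a b] by blast
  obtain L where L: "L \<ge> 0" "\<And>s. a \<le> Re s \<Longrightarrow> Re s \<le> b \<Longrightarrow> 1 \<le> \<bar>Im s\<bar> \<Longrightarrow> norm (g s) \<le> L / \<bar>Im s\<bar> ^ M"
    using strip_decayE[OF assms(2), of a b] by blast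
  have "norm (f s * g s) \<le> (K / \<bar>Im s\<bar> ^ N) * (L / \<bar>Im s\<bar> ^ M)"
    if "a \<le> Re s" "Re s \<le> b" "1 \<le> \<bar>Im s\<bar>" for s
    unfolding norm_mult using K L that by (intro mult_mono) auto
  then show "\<exists>K. \<forall>s. a \<le> Re s \<longrightarrow> Re s \<le> b \<longrightarrow> 1 \<le> \<bar>Im s\<bar> \<longrightarrow> norm (f s * g s) \<le> K / \<bar>Im s\<bar> ^ (N + M)"
    by (intro exI[of _ "K * L"]) (simp add: power_add)
qed

text \<open>The map sends a strip into the strip of radius \<open>M\<close> around \<open>u\<close>,
  and \<open>\<bar>v\<bar> \<ge> 1\<close> ensures that imaginary parts do not shrink. It covers the
  shifts \<open>w + s\<close>, the reflection \<open>1 - s\<close> and the scaling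
  \<open>r * s\<close>.\<close>

lemma strip_decay_affine:
  fixes u v :: real
  assumes f: "strip_decay N f" and v: "\<bar>v\<bar> \<ge> 1"
  shows "strip_decay N (\<lambda>s. f (of_real u + of_real v * s))"
  unfolding strip_decay_def
proof (intro allI)
  fix a b :: real
  define M where "M = \<bar>v\<bar> * max \<bar>a\<bar> \<bar>b\<bar>"
  obtain K where K: "K \<ge> 0" "\<And>s. u - M \<le> Re s \<Longrightarrow> Re s \<le> u + M \<Longrightarrow> 1 \<le> \<bar>Im s\<bar> \<Longrightarrow> norm (f s) \<le> K / \<bar>Im s\<bar> ^ N"
    using strip_decayE[OF f, of "u - M" "u + M"] by blast
  have "norm (f (of_real u + of_real v * s)) \<le> K / \<bar>Im s\<bar> ^ N"
    if s: "a \<le> Re s" "Re s \<le> b" "1 \<le> \<bar>Im s\<bar>" for s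
  proof -
    have "\<bar>v * Re s\<bar> \<le> M" unfolding M_def abs_mult using s by (intro mult_left_mono) auto
    moreover have le: "\<bar>Im s\<bar> \<le> \<bar>v * Im s\<bar>"
      using mult_right_mono[OF v, of "\<bar>Im s\<bar>"] by (simp add: abs_mult)
    ultimately have "norm (f (of_real u + of_real v * s)) \<le> K / \<bar>v * Im s\<bar> ^ N"
      using K(2)[of "of_real u + of_real v * s"] s by simp
    also have "\<dots> \<le> K / \<bar>Im s\<bar> ^ N"
      using le K(1) s by (intro divide_left_mono power_mono mult_pos_pos) auto
    finally show ?thesis .
  qed
  then show "\<exists>K. \<forall>s. a \<le> Re s \<longrightarrow> Re s \<le> b \<longrightarrow> 1 \<le> \<bar>Im s\<bar> \<longrightarrow>
      norm (f (of_real u + of_real v * s)) \<le> K / \<bar>Im s\<bar> ^ N" by blast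
qed

lemma strip_decay_const: "strip_decay 0 (\<lambda>_. c)"
  by (auto simp: strip_decay_def)

lemma strip_decay_inverse: "strip_decay 0 (\<lambda>s. inverse (of_real x + s))"
  unfolding strip_decay_def
proof (intro allI exI[of _ 1] impI)
  fix s :: complex assume "1 \<le> \<bar>Im s\<bar>"
  then have "1 \<le> norm (of_real x + s)" using abs_Im_le_cmod[of "of_real x + s"] by simp
  then show "norm (inverse (of_real x + s)) \<le> 1 / \<bar>Im s\<bar> ^ 0"
    by (simp add: norm_inverse inverse_le_1_iff)
qed

lemma norm_of_real_powr_minus:
  fixes s :: complex
  assumes "z > 0"
  shows "norm (of_real z powr (- s)) = z powr (- Re s)"
  using assms by (simp add: norm_powr_real_powr)

lemma complex_powr_exp_ln:
  fixes z :: complex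
  assumes "x > 0"
  shows "of_real x powr z = exp (z * of_real (ln x))"
  using assms by (simp add: powr_def Ln_of_real)

lemma strip_decay_powr:
  assumes z: "z > 0"
  shows "strip_decay 0 (\<lambda>s. of_real z powr (- s))"
  unfolding strip_decay_def
proof (intro allI)
  fix a b :: real
  have "compact ((\<lambda>x. z powr (- x)) ` {a..b})"
    by (intro compact_continuous_image continuous_intros) (use z in auto)
  then obtain K where "\<And>x. x \<in> {a..b} \<Longrightarrow> norm (z powr (- x)) \<le> K"
    by (meson bounded_iff compact_imp_bounded imageI)
  then show "\<exists>K. \<forall>s. a \<le> Re s \<longrightarrow> Re s \<le> b \<longrightarrow> 1 \<le> \<bar>Im s\<bar> \<longrightarrow>
      norm (of_real z powr (- s)) \<le> K / \<bar>Im s\<bar> ^ 0"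
    using z by (intro exI[of _ K]) (simp add: norm_of_real_powr_minus)
qed

text \<open>The recurrence trades a shift to the right by \<open>k\<close> for a factor \<open>\<bar>Im s\<bar> ^ k\<close>.\<close>

lemma strip_decay_Gamma: "strip_decay N Gamma"
  unfolding strip_decay_def
proof (intro allI)
  fix a b :: real
  \<comment> \<open>\<open>N\<close> steps of the recurrence pay for the decay; the others move the
    strip into \<open>Re s \<ge> 1\<close>, where \<open>Gamma\<close> is bounded. Every Pochhammer
    factor has modulus at least \<open>\<bar>Im s\<bar> \<ge> 1\<close>, so the surplus steps do no
    harm.\<close>
  define k where "k = N + nat \<lceil>1 - a\<rceil>"
  have k: "k \<ge> N" "a + real k \<ge> 1" unfolding k_def by linarith+
  have "continuous_on {a + real k..b + real k} (Gamma :: real \<Rightarrow> real)"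
    using k by (intro continuous_on_Gamma) (auto elim!: nonpos_Ints_cases)
  then have "compact (Gamma ` {a + real k..b + real k})"
    by (intro compact_continuous_image) auto
  then obtain B where B: "\<And>x. x \<in> {a + real k..b + real k} \<Longrightarrow> norm (Gamma x) \<le> B"
    by (meson bounded_iff compact_imp_bounded imageI)
  have "norm (Gamma s) \<le> B / \<bar>Im s\<bar> ^ N" if s: "a \<le> Re s" "Re s \<le> b" "1 \<le> \<bar>Im s\<bar>" for s
  proof -
    have "s \<notin> \<int>\<^sub>\<le>\<^sub>0" using s by (auto elim!: nonpos_Ints_cases)
    then have eq: "pochhammer s k * Gamma s = Gamma (s + of_nat k)"
      using pochhammer_Gamma[of s k] by (simp add: Gamma_eq_zero_iff)
    have "\<bar>Im s\<bar> ^ N \<le> \<bar>Im s\<bar> ^ k" using s k by (intro power_increasing) auto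
    also have "\<dots> = (\<Prod>i = 0..<k. \<bar>Im s\<bar>)" by simp
    also have "\<dots> \<le> (\<Prod>i = 0..<k. norm (s + of_nat i))"
    proof (intro prod_mono conjI)
      show "\<bar>Im s\<bar> \<le> norm (s + of_nat i)" for i using abs_Im_le_cmod[of "s + of_nat i"] by simp
    qed auto
    also have "\<dots> = norm (pochhammer s k)" by (simp add: pochhammer_prod prod_norm)
    finally have p: "\<bar>Im s\<bar> ^ N \<le> norm (pochhammer s k)" .
    have "\<bar>Im s\<bar> ^ N * norm (Gamma s) \<le> norm (pochhammer s k) * norm (Gamma s)"
      using p by (intro mult_right_mono) auto
    also have "\<dots> = norm (Gamma (s + of_nat k))" by (simp add: norm_mult flip: eq)
    also have "\<dots> \<le> Gamma (Re s + real k)"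
      using norm_Gamma_complex_le[of "s + of_nat k"] s k by simp
    also have "\<dots> \<le> B" using B[of "Re s + real k"] s by simp
    finally show ?thesis using s by (simp add: field_simps)
  qed
  then show "\<exists>K. \<forall>s. a \<le> Re s \<longrightarrow> Re s \<le> b \<longrightarrow> 1 \<le> \<bar>Im s\<bar> \<longrightarrow> norm (Gamma s) \<le> K / \<bar>Im s\<bar> ^ N"
    by blast
qed

lemma strip_decay_2D:
  assumes "strip_decay 2 f"
  shows "\<exists>K. \<forall>s. a \<le> Re s \<longrightarrow> Re s \<le> b \<longrightarrow> 1 \<le> \<bar>Im s\<bar> \<longrightarrow> norm (f s) \<le> K / (Im s)\<^sup>2"
  using assms unfolding strip_decay_def by simp

section \<open>The two Meijer functions as line integrals\<close>

text \<open>
  Off the poles this is the Mellin transform of the Meijer function in the optical density, because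
  there \<open>Gamma (x + s) / Gamma (x + 1 + s) = 1 / (x + s)\<close>.
\<close>

definition optical_mellin :: "real \<Rightarrow> real \<Rightarrow> real \<Rightarrow> complex \<Rightarrow> complex" where
  "optical_mellin x \<alpha> \<nu> s = Gamma (of_real \<alpha> + s) * Gamma (of_real \<nu> + s) * inverse (of_real x + s)"

lemma strip_decay_Gamma_shift: "strip_decay N (\<lambda>s. Gamma (of_real w + s))"
  using strip_decay_affine[OF strip_decay_Gamma, of 1 N w] by simp

lemma strip_decay_optical_mellin: "strip_decay 2 (optical_mellin x \<alpha> \<nu>)"
proof -
  have "strip_decay (2 + 0 + 0) (optical_mellin x \<alpha> \<nu>)"
    unfolding optical_mellin_def[abs_def]
    by (intro strip_decay_mult strip_decay_Gamma_shift strip_decay_inverse)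
  then show ?thesis by simp
qed

text \<open>This condition on \<open>s\<close> recurs below: its first half covers the region where
  decay is measured, its second half the lines of integration. It excludes the poles, where the
  default value 0 of \<open>Gamma\<close> can spoil cancellations.\<close>

lemma not_nonpos_Int_shift:
  assumes "Im s \<noteq> 0 \<or> Re s > 0" "x \<ge> 0"
  shows "of_real x + s \<notin> \<int>\<^sub>\<le>\<^sub>0"
proof
  assume "of_real x + s \<in> \<int>\<^sub>\<le>\<^sub>0"
  then obtain k where "of_real x + s = - of_nat k" by (elim nonpos_Ints_cases')
  then have "s = of_real (- real k - x)" by (simp add: algebra_simps eq_neg_iff_add_eq_0)
  then show False using assms by auto
qed

lemma Gamma_quotient:
  assumes "Im s \<noteq> 0 \<or> Re s > 0" "x \<ge> 0"
  shows "Gamma (of_real x + s) = Gamma (of_real x + 1 + s) * inverse (of_real x + s)"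
proof -
  have "of_real x + s \<noteq> 0" using not_nonpos_Int_shift[OF assms] by auto
  then show ?thesis
    using Gamma_plus1[OF not_nonpos_Int_shift[OF assms]] by (simp add: field_simps)
qed

lemma meijer_integrand_optical_density:
  assumes s: "Im s \<noteq> 0 \<or> Re s > 0" and x: "x > 0"
  shows "meijer_integrand 3 0 [of_real (x + 1)] [of_real x, of_real \<alpha>, of_real \<nu>] z s =
    optical_mellin x \<alpha> \<nu> s * z powr (- s)"
proof -
  have "Gamma (of_real (x + 1) + s) \<noteq> 0"
    using not_nonpos_Int_shift[OF s, of "x + 1"] x by (simp add: Gamma_eq_zero_iff)
  then show ?thesis
    using Gamma_quotient[OF s, of x] x
    by (simp add: meijer_integrand_def optical_mellin_def eval_nat_numeral lessThan_Suc mult_ac)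
qed

text \<open>For \<open>r = 2\<close>, the list of \<open>x\<close> cancels against that of
  \<open>x + 1\<close> up to the factor \<open>2 / (x + 2 s)\<close>. Duplication turns each of the
  lists of \<open>\<alpha>\<close> and \<open>\<nu>\<close> into one Gamma factor at
  \<open>2 s\<close>, with a factor \<open>sqrt pi * 2 powr (1 - y)\<close> and the power
  \<open>2 powr (- 2 s)\<close>. Together these give the constant
  \<open>2 * pi * 2 powr (2 - \<alpha> - \<nu>)\<close> and \<open>16 powr (- s)\<close>, where
  \<open>16 = r ^ (2 * r)\<close>.\<close>

lemma meijer_integrand_capacity:
  assumes s: "Im s \<noteq> 0 \<or> Re s > 0" and x: "x > 0" and \<alpha>\<nu>: "\<alpha> > 0" "\<nu> > 0"
    and r: "r \<in> {1, 2}" and Z: "Z > 0"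
  shows "meijer_integrand (3 * r + 1) 1 (map of_real (0 # Delta r (x + 1)))
      (map of_real (Delta r x @ Delta r \<alpha> @ Delta r \<nu> @ [0])) (of_real Z) s =
    of_real ((2 * pi) ^ (r - 1) * real r powr (2 - \<alpha> - \<nu>)) *
    (optical_mellin x \<alpha> \<nu> (of_nat r * s) * (Gamma s * Gamma (1 - s)) *
     of_real (real r ^ (2 * r) * Z) powr (- s))"
proof (cases "r = 1")
  case True
  have "Gamma (of_real (x + 1) + s) \<noteq> 0"
    using not_nonpos_Int_shift[OF s, of "x + 1"] x by (simp add: Gamma_eq_zero_iff)
  then show ?thesis using True Gamma_quotient[OF s, of x] x
    by (simp add: meijer_integrand_def optical_mellin_def Delta_def eval_nat_numeral lessThan_Suc mult_ac)
next
  case False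
  then have r: "r = 2" using r by auto
  have s2: "Im (2 * s) \<noteq> 0 \<or> Re (2 * s) > 0" using s by simp
  \<comment> \<open>The power \<open>2 powr (- 2 s)\<close> that each duplication leaves, in the
    exponential form of the duplication formula.\<close>
  define w where "w = exp (- (2 * s) * of_real (ln 2))"
  have dup: "Gamma (of_real (y / 2) + s) * Gamma (of_real ((y + 1) / 2) + s) =
      of_real (2 powr (1 - y) * sqrt pi) * w * Gamma (of_real y + 2 * s)" if "y > 0" for y
  proof -
    define u where "u = of_real (y / 2) + s"
    have half: "of_real ((y + 1) / 2) + s = u + 1 / 2"
      by (simp add: u_def add_divide_distrib)
    have "u \<notin> \<int>\<^sub>\<le>\<^sub>0" "u + 1 / 2 \<notin> \<int>\<^sub>\<le>\<^sub>0"
      using that not_nonpos_Int_shift[OF s, of "y / 2"] not_nonpos_Int_shift[OF s, of "(y + 1) / 2"]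
      unfolding half u_def by simp_all
    then have "Gamma u * Gamma (u + 1 / 2) =
        exp ((1 - 2 * u) * of_real (ln 2)) * of_real (sqrt pi) * Gamma (2 * u)"
      by (rule Gamma_legendre_duplication)
    moreover have "exp ((1 - 2 * u) * of_real (ln 2)) = of_real (2 powr (1 - y)) * w"
      by (simp add: u_def w_def powr_def algebra_simps flip: exp_add exp_of_real)
    moreover have "2 * u = of_real y + 2 * s" by (simp add: u_def)
    ultimately show ?thesis unfolding half u_def[symmetric] by (simp add: mult_ac)
  qed
  have nz: "Gamma (of_real ((x + 1) / 2) + s) \<noteq> 0" "Gamma (of_real ((x + 2) / 2) + s) \<noteq> 0"
    using not_nonpos_Int_shift[OF s, of "(x + 1) / 2"] not_nonpos_Int_shift[OF s, of "(x + 2) / 2"] x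
    by (simp_all add: Gamma_eq_zero_iff)
  have quot: "Gamma (of_real (x / 2) + s) = Gamma (of_real ((x + 2) / 2) + s) * (2 * inverse (of_real x + 2 * s))"
  proof -
    have eq: "of_real ((x + 2) / 2) + s = of_real (x / 2) + 1 + s" by (simp add: add_divide_distrib)
    have "inverse (of_real (x / 2) + s) = 2 * inverse (of_real x + 2 * s)"
      using nonzero_inverse_mult_distrib[of 2 "of_real (x / 2) + s"] by (simp add: field_simps)
    then show ?thesis unfolding eq using Gamma_quotient[OF s, of "x / 2"] x by simp
  qed
  \<comment> \<open>Here \<open>g\<close> and \<open>h\<close> are the Gamma factors at
    \<open>(x + 1) / 2 + s\<close> and \<open>(x + 2) / 2 + s\<close>, and \<open>q\<close> is the
    quotient factor from \<open>quot\<close>.\<close>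
  have cancel: "(h * q) * g * a * b * d / (g * h) * e = q * (a * b) * d * e"
    if "g \<noteq> 0" "h \<noteq> 0" for a b d e g h q :: complex
    using that by simp
  have p16: "of_real (16 * Z) powr (- s) = w * w * of_real Z powr (- s)"
  proof -
    have "ln (16::real) = 4 * ln 2" using ln_realpow[of "2::real" 4] by simp
    then have "ln (16 * Z) = 4 * ln 2 + ln Z" using Z by (simp add: ln_mult)
    then show ?thesis
      using Z unfolding w_def
      by (subst (1 2) complex_powr_exp_ln) (simp_all add: algebra_simps flip: exp_add)
  qed
  have coeff: "2 powr (1 - \<alpha>) * sqrt pi * (2 powr (1 - \<nu>) * sqrt pi) * 2 =
      2 * pi * 2 powr (2 - \<alpha> - \<nu>)"
  proof -
    have "2 powr (1 - \<alpha>) * 2 powr (1 - \<nu>) = 2 powr (2 - \<alpha> - \<nu>)"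
      by (simp add: algebra_simps flip: powr_add)
    then show ?thesis by (simp add: mult_ac)
  qed
  have "meijer_integrand (3 * r + 1) 1 (map of_real (0 # Delta r (x + 1)))
      (map of_real (Delta r x @ Delta r \<alpha> @ Delta r \<nu> @ [0])) (of_real Z) s =
     (Gamma (of_real (x / 2) + s) * Gamma (of_real ((x + 1) / 2) + s)) *
     (Gamma (of_real (\<alpha> / 2) + s) * Gamma (of_real ((\<alpha> + 1) / 2) + s)) *
     (Gamma (of_real (\<nu> / 2) + s) * Gamma (of_real ((\<nu> + 1) / 2) + s)) *
     (Gamma s * Gamma (1 - s)) /
     (Gamma (of_real ((x + 1) / 2) + s) * Gamma (of_real ((x + 2) / 2) + s)) * of_real Z powr (- s)"
    unfolding meijer_integrand_def Delta_def r
    by (simp add: eval_nat_numeral lessThan_Suc atLeastLessThanSuc mult_ac add_ac)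
  also have "\<dots> = (2 * inverse (of_real x + 2 * s)) *
     ((of_real (2 powr (1 - \<alpha>) * sqrt pi) * w * Gamma (of_real \<alpha> + 2 * s)) *
     (of_real (2 powr (1 - \<nu>) * sqrt pi) * w * Gamma (of_real \<nu> + 2 * s))) *
     (Gamma s * Gamma (1 - s)) * of_real Z powr (- s)"
    unfolding dup[OF \<alpha>\<nu>(1)] dup[OF \<alpha>\<nu>(2)] quot by (rule cancel[OF nz])
  also have "\<dots> = of_real (2 powr (1 - \<alpha>) * sqrt pi * (2 powr (1 - \<nu>) * sqrt pi) * 2) *
     (optical_mellin x \<alpha> \<nu> (2 * s) * (Gamma s * Gamma (1 - s)) * (w * w * of_real Z powr (- s)))"
    by (simp add: optical_mellin_def mult_ac)
  also have "\<dots> = of_real (2 * pi * 2 powr (2 - \<alpha> - \<nu>)) *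
     (optical_mellin x \<alpha> \<nu> (2 * s) * (Gamma s * Gamma (1 - s)) * of_real (16 * Z) powr (- s))"
    unfolding coeff p16 ..
  finally show ?thesis unfolding r by simp
qed

text \<open>All poles lie to the left of 0 and none has to lie on the right, so every
  \<open>c > 0\<close> is admissible. This freedom is used with \<open>c = 1\<close> for reality and
  \<open>c = r / 2\<close> for the Stieltjes transform.\<close>

lemma meijer_G_optical_density:
  assumes pos: "x > 0" "\<alpha> > 0" "\<nu> > 0" and c: "c > 0" and z: "z > 0"
  defines "f \<equiv> \<lambda>y. optical_mellin x \<alpha> \<nu> (Complex c y) * of_real z powr (- Complex c y)"
  shows "integrable lborel f"
    and "meijer_G 3 0 [of_real (x + 1)] [of_real x, of_real \<alpha>, of_real \<nu>] (of_real z) =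
      (\<integral>y. f y \<partial>lborel) / (2 * of_real pi)"
proof -
  let ?f = "meijer_integrand 3 0 (map of_real [x + 1]) (map of_real [x, \<alpha>, \<nu>]) (of_real z)"
  have eq: "?f s = optical_mellin x \<alpha> \<nu> s * of_real z powr (- s)" if "Im s \<noteq> 0 \<or> Re s > 0" for s
    using meijer_integrand_optical_density[OF that pos(1), of \<alpha> \<nu> "of_real z"] by simp
  have "strip_decay (2 + 0) (\<lambda>s. optical_mellin x \<alpha> \<nu> s * of_real z powr (- s))"
    by (intro strip_decay_mult strip_decay_optical_mellin strip_decay_powr z)
  then have "strip_decay 2 (\<lambda>s. optical_mellin x \<alpha> \<nu> s * of_real z powr (- s))"
    by (simp only: add_0_right)
  then have decay: "strip_decay 2 ?f"
    by (rule strip_decay_cong) (use eq in auto)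
  have line: "?f (Complex c y) = f y" for y using eq[of "Complex c y"] c by (simp add: f_def)
  have bs: "- ([x, \<alpha>, \<nu>] ! j) < c" if "j < 3" for j
    using nth_mem[of j "[x, \<alpha>, \<nu>]"] that pos c by auto
  have *: "integrable lborel (\<lambda>y. ?f (Complex c y))"
     "meijer_G 3 0 (map of_real [x + 1]) (map of_real [x, \<alpha>, \<nu>]) (of_real z) =
       (\<integral>y. ?f (Complex c y) \<partial>lborel) / (2 * of_real pi)"
    by (rule meijer_G_eq_line_integral; use z bs strip_decay_2D[OF decay] in simp)+
  show "integrable lborel f" using *(1) unfolding line .
  show "meijer_G 3 0 [of_real (x + 1)] [of_real x, of_real \<alpha>, of_real \<nu>] (of_real z) =
      (\<integral>y. f y \<partial>lborel) / (2 * of_real pi)"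
    using *(2) unfolding line by simp
qed

lemma cnj_optical_mellin: "cnj (optical_mellin x \<alpha> \<nu> s) = optical_mellin x \<alpha> \<nu> (cnj s)"
  by (simp add: optical_mellin_def cnj_Gamma)

text \<open>Conjugating the integrand reflects \<open>y\<close> to \<open>- y\<close>, so the line
  integral is its own conjugate. The \<open>Re\<close> in the density therefore loses nothing, and
  the complex line integral can replace it.\<close>

lemma meijer_G_optical_density_real:
  assumes pos: "x > 0" "\<alpha> > 0" "\<nu> > 0" and z: "z > 0"
  shows "of_real (Re (meijer_G 3 0 [of_real (x + 1)] [of_real x, of_real \<alpha>, of_real \<nu>] (of_real z))) =
    meijer_G 3 0 [of_real (x + 1)] [of_real x, of_real \<alpha>, of_real \<nu>] (of_real z)"
proof -
  define f where "f = (\<lambda>y. optical_mellin x \<alpha> \<nu> (Complex 1 y) * of_real z powr (- Complex 1 y))"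
  have cnj_f: "cnj (f y) = f (0 + (- 1) * y)" for y
  proof -
    have "cnj (Complex 1 y) = Complex 1 (- y)" by (simp add: complex_cnj)
    moreover have "cnj (of_real z powr (- Complex 1 y)) = of_real z powr (- cnj (Complex 1 y))"
      using z by (simp add: complex_powr_exp_ln exp_cnj)
    ultimately show ?thesis by (simp add: f_def cnj_optical_mellin)
  qed
  have "cnj (\<integral>y. f y \<partial>lborel) = (\<integral>y. f (0 + (- 1) * y) \<partial>lborel)"
    unfolding Bochner_Integration.integral_cnj[symmetric] cnj_f ..
  also have "\<dots> = (\<integral>y. f y \<partial>lborel)"
    using lborel_integral_real_affine[of "-1" f 0] by simp
  finally have "(\<integral>y. f y \<partial>lborel) \<in> \<real>" by (simp add: Reals_cnj_iff)
  then show ?thesis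
    unfolding meijer_G_optical_density(2)[OF pos zero_less_one z] f_def[symmetric]
    by (intro of_real_Re) (simp add: Reals_divide)
qed

text \<open>The parameters 0 contribute left poles from 0 downwards and right poles from 1 upwards,
  hence the range \<open>0 < c < 1\<close>.\<close>

lemma meijer_G_capacity:
  assumes pos: "x > 0" "\<alpha> > 0" "\<nu> > 0" and r: "r \<in> {1, 2}" and c: "0 < c" "c < 1" and Z: "Z > 0"
  shows "meijer_G (3 * r + 1) 1 (map of_real (0 # Delta r (x + 1)))
      (map of_real (Delta r x @ Delta r \<alpha> @ Delta r \<nu> @ [0])) (of_real Z) =
    of_real ((2 * pi) ^ (r - 1) * real r powr (2 - \<alpha> - \<nu>)) *
    (\<integral>y. optical_mellin x \<alpha> \<nu> (of_nat r * Complex c y) *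
      (Gamma (Complex c y) * Gamma (1 - Complex c y)) *
      of_real (real r ^ (2 * r) * Z) powr (- Complex c y) \<partial>lborel) / (2 * of_real pi)"
proof -
  let ?as = "0 # Delta r (x + 1)" and ?bs = "Delta r x @ Delta r \<alpha> @ Delta r \<nu> @ [0]"
  let ?f = "meijer_integrand (3 * r + 1) 1 (map of_real ?as) (map of_real ?bs) (of_real Z)"
  define k where "k = complex_of_real ((2 * pi) ^ (r - 1) * real r powr (2 - \<alpha> - \<nu>))"
  let ?h = "\<lambda>s. optical_mellin x \<alpha> \<nu> (of_nat r * s) * (Gamma s * Gamma (1 - s)) *
      of_real (real r ^ (2 * r) * Z) powr (- s)"
  have eq: "?f s = k * ?h s" if "Im s \<noteq> 0 \<or> Re s > 0" for s
    unfolding k_def by (rule meijer_integrand_capacity[OF that pos r Z])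
  have "strip_decay (0 + (2 + (0 + 0) + 0)) (\<lambda>s. k * ?h s)"
  proof (intro strip_decay_mult strip_decay_const strip_decay_Gamma strip_decay_powr)
    show "strip_decay 2 (\<lambda>s. optical_mellin x \<alpha> \<nu> (of_nat r * s))"
      using strip_decay_affine[OF strip_decay_optical_mellin, of "real r" x \<alpha> \<nu> 0] r by auto
    show "strip_decay 0 (\<lambda>s. Gamma (1 - s))"
      using strip_decay_affine[OF strip_decay_Gamma, of "-1" 0 1] by simp
  qed (use r Z in auto)
  then have "strip_decay 2 (\<lambda>s. k * ?h s)"
    by (simp only: add_0_left add_0_right)
  then have decay: "strip_decay 2 ?f"
    by (rule strip_decay_cong) (use eq in auto)
  have line: "?f (Complex c y) = k * ?h (Complex c y)" for y using eq[of "Complex c y"] c by simp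
  have len: "length ?bs = 3 * r + 1" by (simp add: Delta_def)
  have "\<forall>b \<in> set ?bs. b \<ge> 0" using pos by (auto simp: Delta_def)
  then have bs: "- (?bs ! j) < c" if "j < 3 * r + 1" for j
    using nth_mem[of j ?bs] that len c by fastforce
  have "meijer_G (3 * r + 1) 1 (map of_real ?as) (map of_real ?bs) (of_real Z) =
     (\<integral>y. ?f (Complex c y) \<partial>lborel) / (2 * of_real pi)"
    by (rule meijer_G_eq_line_integral(2); use Z bs len c strip_decay_2D[OF decay] in simp)
  then show ?thesis unfolding line integral_mult_right_zero k_def .
qed

section \<open>Stieltjes transforms\<close>

text \<open>Euler's integral in the shape that Fubini's theorem needs: over \<open>lborel\<close>,
  and with the power written through \<open>exp\<close> and \<open>ln\<close>, which is measurable
  by composition and lets exponents merge.\<close>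

lemma Gamma_integral_lborel:
  assumes z: "Re z > 0"
  defines "J \<equiv> \<lambda>t::real. indicator {0<..} t *\<^sub>R (exp ((z - 1) * of_real (ln t)) * of_real (exp (- t)))"
  shows "integrable lborel J" "(\<integral>t. J t \<partial>lborel) = Gamma z"
proof -
  have J: "J t = (if t \<in> {0<..} then of_real t powr (z - 1) / of_real (exp t) else 0)" for t
    unfolding J_def by (simp add: complex_powr_exp_ln exp_minus divide_inverse)
  have [measurable]: "J \<in> borel_measurable borel" unfolding J_def by measurable
  have "integrable lebesgue J"
    using absolutely_integrable_Gamma_integral'[OF z] unfolding set_integrable_def
    by (rule Bochner_Integration.integrable_cong[THEN iffD1, rotated 2]) (auto simp: J)
  then show int: "integrable lborel J" by (subst (asm) integrable_completion) auto
  have "(J has_integral Gamma z) UNIV"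
    using Gamma_integral_complex'[OF z] unfolding J by (simp only: has_integral_restrict_UNIV)
  then show "(\<integral>t. J t \<partial>lborel) = Gamma z"
    using has_integral_integral_lborel[OF int] has_integral_unique by blast
qed

lemma Gamma_integral_scaled:
  assumes z: "Re z > 0" and u: "u > 0"
  defines "J \<equiv> \<lambda>t::real. indicator {0<..} t *\<^sub>R (exp ((z - 1) * of_real (ln t)) * of_real (exp (- (u * t))))"
  shows "integrable lborel J" "(\<integral>t. J t \<partial>lborel) = Gamma z * exp (- (z * of_real (ln u)))"
proof -
  define J1 where "J1 = (\<lambda>t::real. indicator {0<..} t *\<^sub>R (exp ((z - 1) * of_real (ln t)) * of_real (exp (- t))))"
  have J1: "integrable lborel J1" "(\<integral>t. J1 t \<partial>lborel) = Gamma z"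
    unfolding J1_def by (rule Gamma_integral_lborel[OF z])+
  \<comment> \<open>The substitution \<open>t\<close> to \<open>u * t\<close> costs
    \<open>u powr (- (z - 1))\<close>, which is \<open>k\<close>; the Jacobian supplies the missing
    factor \<open>1 / u\<close>.\<close>
  define k where "k = exp (- ((z - 1) * of_real (ln u)))"
  have J: "J = (\<lambda>t. k * J1 (0 + u * t))"
  proof
    fix t
    show "J t = k * J1 (0 + u * t)"
    proof (cases "t > 0")
      case True
      then have "exp ((z - 1) * of_real (ln t)) = k * exp ((z - 1) * of_real (ln (u * t)))"
        using u by (simp add: k_def ln_mult algebra_simps flip: exp_add)
      then show ?thesis using True u by (simp add: J_def J1_def)
    qed (use u in \<open>simp add: J_def J1_def zero_less_mult_iff\<close>)
  qed
  show "integrable lborel J"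
    unfolding J using lborel_integrable_real_affine[OF J1(1), of u 0] u
    by (intro integrable_mult_right) auto
  have "Gamma z = u *\<^sub>R (\<integral>t. J1 (0 + u * t) \<partial>lborel)"
    using lborel_integral_real_affine[of u J1 0] u J1(2) by simp
  then have "(\<integral>t. J1 (0 + u * t) \<partial>lborel) = Gamma z / of_real u"
    using u by (simp add: scaleR_conv_of_real field_simps)
  then have "(\<integral>t. J t \<partial>lborel) = k * Gamma z * inverse (of_real u)"
    unfolding J by (simp add: divide_inverse)
  also have "inverse (of_real u) = exp (- of_real (ln u) :: complex)"
    using u by (simp add: exp_minus flip: exp_of_real) (simp add: exp_of_real)
  also have "k * Gamma z * exp (- of_real (ln u)) = Gamma z * exp (- (z * of_real (ln u)))"
    by (simp add: k_def algebra_simps flip: exp_add)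
  finally show "(\<integral>t. J t \<partial>lborel) = Gamma z * exp (- (z * of_real (ln u)))" .
qed

lemma Gamma_integral_scaled_real:
  fixes a u :: real
  assumes a: "a > 0" and u: "u > 0"
  shows "integrable lborel (\<lambda>t. indicator {0<..} t * (exp ((a - 1) * ln t) * exp (- (u * t))))"
    "(\<integral>t. indicator {0<..} t * (exp ((a - 1) * ln t) * exp (- (u * t))) \<partial>lborel) = Gamma a * exp (- (a * ln u))"
proof -
  let ?J = "\<lambda>t::real. indicator {0<..} t *\<^sub>R (exp ((of_real a - 1) * of_real (ln t)) * of_real (exp (- (u * t)))) :: complex"
  have J: "?J t = of_real (indicator {0<..} t * (exp ((a - 1) * ln t) * exp (- (u * t))))" for t
    by (simp add: scaleR_conv_of_real flip: exp_of_real)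
  have 1: "integrable lborel ?J"
    "(\<integral>t. ?J t \<partial>lborel) = Gamma (of_real a) * exp (- (of_real a * of_real (ln u)))"
    by (rule Gamma_integral_scaled; use a u in simp)+
  show "integrable lborel (\<lambda>t. indicator {0<..} t * (exp ((a - 1) * ln t) * exp (- (u * t))))"
    using integrable_Re[OF 1(1)] unfolding J by simp
  have "of_real (\<integral>t. indicator {0<..} t * (exp ((a - 1) * ln t) * exp (- (u * t))) \<partial>lborel) =
      complex_of_real (Gamma a * exp (- (a * ln u)))"
    using 1(2) unfolding J integral_complex_of_real by (simp add: Gamma_complex_of_real flip: exp_of_real)
  then show "(\<integral>t. indicator {0<..} t * (exp ((a - 1) * ln t) * exp (- (u * t))) \<partial>lborel) = Gamma a * exp (- (a * ln u))"
    unfolding of_real_eq_iff .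
qed

text \<open>Write \<open>1 / (x + D)\<close> as the Laplace integral of \<open>exp (- u (x + D))\<close> and integrate over \<open>x\<close> first.\<close>

lemma Stieltjes_transform_power:
  assumes w: "0 < Re w" "Re w < 1" and D: "D > 0"
  defines "S \<equiv> \<lambda>x::real. indicator {0<..} x *\<^sub>R (exp (- (w * of_real (ln x))) / of_real (x + D))"
  shows "integrable lborel S"
    "(\<integral>x. S x \<partial>lborel) = Gamma w * Gamma (1 - w) * exp (- (w * of_real (ln D)))"
proof -
  define F where "F = (\<lambda>(u::real) (x::real). indicator {0<..} u *\<^sub>R indicator {0<..} x *\<^sub>R
    (exp (- (w * of_real (ln x))) * of_real (exp (- (u * (x + D)))) :: complex))"
  have [measurable]: "(\<lambda>(u, x). F u x) \<in> borel_measurable (lborel \<Otimes>\<^sub>M lborel)"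
    unfolding F_def by measurable
  define a where "a = Re w"
  have Fx: "F u x = (indicator {0<..} u * exp (- (u * D))) *\<^sub>R
      (indicator {0<..} x *\<^sub>R (exp (((1 - w) - 1) * of_real (ln x)) * of_real (exp (- (u * x)))))" for u x
    by (simp add: F_def scaleR_conv_of_real algebra_simps exp_add exp_diff exp_minus divide_inverse flip: exp_of_real)
  \<comment> \<open>The same kernel regrouped for integration over \<open>u\<close>: the trivial
    factor with exponent \<open>1 - 1\<close> presents it as a Gamma integral at
    \<open>z = 1\<close>, with value \<open>1 / (x + D)\<close>.\<close>
  have Fu: "F u x = (indicator {0<..} x *\<^sub>R exp (- (w * of_real (ln x)))) *
      (indicator {0<..} u *\<^sub>R (exp ((1 - 1) * of_real (ln u)) * of_real (exp (- ((x + D) * u)))))" for u x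
    by (simp add: F_def scaleR_conv_of_real algebra_simps)
  \<comment> \<open>The modulus is the kernel with \<open>w\<close> replaced by its real part
    \<open>a\<close>, so absolute integrability is the real case of the same computation; it uses
    \<open>1 - a > 0\<close> in \<open>x\<close> and \<open>a > 0\<close> in
    \<open>u\<close>.\<close>
  have Fn: "norm (F u x) = (indicator {0<..} u * exp (- (u * D))) *
      (indicator {0<..} x * (exp (((1 - a) - 1) * ln x) * exp (- (u * x))))" for u x
    by (simp add: Fx a_def norm_mult norm_exp_eq_Re)
  have intFx: "integrable lborel (F u)" for u
  proof (cases "u > 0")
    case True
    show ?thesis unfolding Fx[abs_def]
      by (intro integrable_scaleR_right Gamma_integral_scaled) (use w True in auto)
  qed (simp add: F_def)
  have innx: "(\<integral>x. F u x \<partial>lborel) = Gamma (1 - w) *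
      (indicator {0<..} u *\<^sub>R (exp ((w - 1) * of_real (ln u)) * of_real (exp (- (D * u)))))" for u
  proof (cases "u > 0")
    case True
    then show ?thesis unfolding Fx integral_scaleR_right
      using w by (subst Gamma_integral_scaled) (simp_all add: scaleR_conv_of_real algebra_simps)
  qed (simp add: F_def)
  have innn: "(\<integral>x. norm (F u x) \<partial>lborel) = Gamma (1 - a) *
      (indicator {0<..} u * (exp ((a - 1) * ln u) * exp (- (D * u))))" for u
  proof (cases "u > 0")
    case True
    then show ?thesis unfolding Fn integral_mult_right_zero
      using w by (subst Gamma_integral_scaled_real) (simp_all add: a_def algebra_simps)
  qed (simp add: F_def)
  have int: "integrable (lborel \<Otimes>\<^sub>M lborel) (\<lambda>(u, x). F u x)"
  proof (rule lborel_pair.Fubini_integrable)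
    show "integrable lborel (\<lambda>u. \<integral>x. norm (case (u, x) of (u, x) \<Rightarrow> F u x) \<partial>lborel)"
      unfolding prod.case innn
      by (intro integrable_mult_right Gamma_integral_scaled_real) (use w D in \<open>auto simp: a_def\<close>)
  qed (use intFx in auto)
  have innu: "(\<integral>u. F u x \<partial>lborel) = S x" for x
  proof (cases "x > 0")
    case True
    have "exp (- (1 * of_real (ln (x + D)))) = inverse (of_real (x + D) :: complex)"
      using True D by (simp add: exp_minus exp_of_real del: of_real_add)
    then show ?thesis unfolding Fu integral_mult_right_zero
      using True D by (subst Gamma_integral_scaled) (simp_all add: S_def divide_inverse)
  qed (simp add: F_def S_def)
  show "integrable lborel S"
    using lborel_pair.integrable_snd[OF int] unfolding innu .
  have "(\<integral>x. S x \<partial>lborel) = (\<integral>u. (\<integral>x. F u x \<partial>lborel) \<partial>lborel)"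
    using lborel_pair.Fubini_integral[OF int] unfolding innu .
  also have "\<dots> = Gamma (1 - w) * (Gamma w * exp (- (w * of_real (ln D))))"
    unfolding innx integral_mult_right_zero using w D by (subst Gamma_integral_scaled) auto
  finally show "(\<integral>x. S x \<partial>lborel) = Gamma w * Gamma (1 - w) * exp (- (w * of_real (ln D)))"
    by (simp add: mult_ac)
qed

text \<open>
  Fubini over the contour and the half-line; the substitution \<open>s = r t\<close> then turns the transform of
  \<open>x powr (- s / r)\<close> into the factor \<open>Gamma t * Gamma (1 - t)\<close>.
\<close>

theorem Stieltjes_transform_meijer_G:
  fixes r :: nat
  assumes pos: "x > 0" "\<alpha> > 0" "\<nu> > 0" and r: "r \<in> {1, 2}" and B: "B > 0" "\<mu> > 0" "D > 0"
  defines "H \<equiv> \<lambda>t::real. Re (meijer_G 3 0 [of_real (x + 1)] [of_real x, of_real \<alpha>, of_real \<nu>]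
    (of_real (B * (t / \<mu>) powr (1 / real r))))"
  shows "integrable lborel (\<lambda>t. indicator {0<..} t * (H t / (t + D)))"
    and "of_real (\<integral>t. indicator {0<..} t * (H t / (t + D)) \<partial>lborel) =
      of_real (real r powr (\<alpha> + \<nu> - 1) / (2 * pi) ^ (r - 1)) *
      meijer_G (3 * r + 1) 1 (map of_real (0 # Delta r (x + 1)))
        (map of_real (Delta r x @ Delta r \<alpha> @ Delta r \<nu> @ [0]))
        (of_real ((B / (real r)\<^sup>2) ^ r * (D / \<mu>)))"
proof -
  have r0: "real r > 0" using r by auto
  \<comment> \<open>Places \<open>w = s / r\<close> on \<open>Re w = 1 / 2\<close>, inside the strip
    where the Stieltjes transform of the power converges.\<close>
  define c where "c = real r / 2"
  have c: "c > 0" "c / real r = 1 / 2" using r0 by (auto simp: c_def)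
  define \<Phi> where "\<Phi> = (\<lambda>y. optical_mellin x \<alpha> \<nu> (Complex c y))"
  have int\<Phi>: "integrable lborel \<Phi>"
    using meijer_G_optical_density(1)[OF pos c(1) zero_less_one] by (simp add: \<Phi>_def)
  have [measurable]: "\<Phi> \<in> borel_measurable borel"
    using borel_measurable_integrable[OF int\<Phi>] by simp
  \<comment> \<open>For the argument \<open>z\<close> of the optical function at \<open>t\<close>,
    \<open>ln z = L + ln t / r\<close>. So \<open>z powr (- s)\<close> splits into a factor free of
    \<open>t\<close>, kept in \<open>E\<close>, and the power \<open>t powr (- s / r)\<close>, kept
    in \<open>S\<close>.\<close>
  define L where "L = ln B - ln \<mu> / real r"
  define w where "w = (\<lambda>y. Complex c y / of_nat r)"
  have w: "Re (w y) = 1 / 2" for y using r0 c by (simp add: w_def c_def)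
  define S where "S = (\<lambda>y (t::real). indicator {0<..} t *\<^sub>R (exp (- (w y * of_real (ln t))) / of_real (t + D)))"
  define E where "E = (\<lambda>y. \<Phi> y * exp (- (Complex c y * of_real L)))"
  define F where "F = (\<lambda>y t. E y * S y t)"
  have [measurable]: "(\<lambda>y. Complex c y) \<in> borel_measurable borel"
    by (intro borel_measurable_continuous_onI) (auto intro!: continuous_intros simp: Complex_eq)
  have meas [measurable]: "(\<lambda>(y, t). F y t) \<in> borel_measurable (lborel \<Otimes>\<^sub>M lborel)"
    unfolding F_def E_def S_def w_def by measurable
  have intS: "integrable lborel (S y)"
    "(\<integral>t. S y t \<partial>lborel) = Gamma (w y) * Gamma (1 - w y) * exp (- (w y * of_real (ln D)))" for y
    unfolding S_def by (rule Stieltjes_transform_power; use w[of y] B in simp)+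
  have normE: "norm (E y) = exp (- (c * L)) * norm (\<Phi> y)" for y
    by (simp add: E_def norm_mult norm_exp_eq_Re mult.commute)
  \<comment> \<open>As \<open>Re (w y)\<close> is constant on the line, the modulus of
    \<open>S y t\<close> does not depend on \<open>y\<close>. The double integral of moduli is then
    a product of two finite integrals.\<close>
  define q where "q = (\<lambda>t. norm (S 0 t))"
  have normS: "norm (S y t) = q t" for y t
    using w[of y] w[of 0] by (simp add: q_def S_def norm_divide norm_exp_eq_Re)
  have int: "integrable (lborel \<Otimes>\<^sub>M lborel) (\<lambda>(y, t). F y t)"
  proof (rule lborel_pair.Fubini_integrable)
    have "(\<integral>t. norm (F y t) \<partial>lborel) = exp (- (c * L)) * (\<integral>t. q t \<partial>lborel) * norm (\<Phi> y)" for y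
      unfolding F_def norm_mult normE normS by simp
    then show "integrable lborel (\<lambda>y. \<integral>t. norm (case (y, t) of (y, t) \<Rightarrow> F y t) \<partial>lborel)"
      unfolding prod.case using int\<Phi> by simp
    show "AE y in lborel. integrable lborel (\<lambda>t. case (y, t) of (y, t) \<Rightarrow> F y t)"
      unfolding prod.case F_def using intS(1) by (intro AE_I2 integrable_mult_right) auto
  qed (rule meas)
  have inner: "(\<integral>y. F y t \<partial>lborel) = of_real (2 * pi * (indicator {0<..} t * (H t / (t + D))))" for t
  proof (cases "t > 0")
    case True
    define z where "z = B * (t / \<mu>) powr (1 / real r)"
    have z: "z > 0" using True B by (simp add: z_def)
    have lnz: "ln z = L + ln t / real r"
      using True B by (simp add: z_def L_def ln_mult ln_powr ln_div diff_divide_distrib)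
    have "of_real (H t) = (\<integral>y. \<Phi> y * of_real z powr (- Complex c y) \<partial>lborel) / (2 * of_real pi)"
      unfolding H_def z_def[symmetric] meijer_G_optical_density_real[OF pos z] \<Phi>_def
      by (rule meijer_G_optical_density(2)[OF pos c(1) z])
    then have H: "(\<integral>y. \<Phi> y * of_real z powr (- Complex c y) \<partial>lborel) = of_real (2 * pi * H t)"
      by (simp add: field_simps)
    have "F y t = (\<Phi> y * of_real z powr (- Complex c y)) * of_real (1 / (t + D))" for y
      using True z by (simp add: F_def E_def S_def w_def complex_powr_exp_ln lnz algebra_simps
          add_divide_distrib divide_inverse exp_add exp_diff exp_minus)
    then have "(\<integral>y. F y t \<partial>lborel) = of_real (2 * pi * H t) * of_real (1 / (t + D))"
      unfolding H[symmetric] by (simp only: integral_mult_left_zero)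
    then show ?thesis using True by (simp flip: of_real_mult of_real_divide)
  qed (simp add: F_def S_def)
  have intH: "integrable lborel (\<lambda>t. complex_of_real (2 * pi * (indicator {0<..} t * (H t / (t + D)))))"
    using lborel_pair.integrable_snd[OF int] unfolding inner .
  from integrable_Re[OF this]
  have "integrable lborel (\<lambda>t. 2 * pi * (indicator {0<..} t * (H t / (t + D))))" by simp
  then have "integrable lborel (\<lambda>t. 1 / (2 * pi) * (2 * pi * (indicator {0<..} t * (H t / (t + D)))))"
    by (rule integrable_mult_right)
  then show "integrable lborel (\<lambda>t. indicator {0<..} t * (H t / (t + D)))"
    by simp
  define Z where "Z = (B / (real r)\<^sup>2) ^ r * (D / \<mu>)"
  have Z: "Z > 0" using B r0 by (simp add: Z_def)
  define k where "k = (2 * pi) ^ (r - 1) * real r powr (2 - \<alpha> - \<nu>)"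
  define h where "h = (\<lambda>y. optical_mellin x \<alpha> \<nu> (of_nat r * Complex (1 / 2) y) *
      (Gamma (Complex (1 / 2) y) * Gamma (1 - Complex (1 / 2) y)) *
      of_real (real r ^ (2 * r) * Z) powr (- Complex (1 / 2) y))"
  have G: "meijer_G (3 * r + 1) 1 (map of_real (0 # Delta r (x + 1)))
      (map of_real (Delta r x @ Delta r \<alpha> @ Delta r \<nu> @ [0])) (of_real Z) =
      of_real k * (\<integral>y. h y \<partial>lborel) / (2 * of_real pi)"
    unfolding h_def k_def by (rule meijer_G_capacity[OF pos r _ _ Z]) auto
  \<comment> \<open>The factor \<open>r ^ (2 * r)\<close> left by duplication cancels the
    denominator of \<open>(B / r\<^sup>2) ^ r\<close>; what remains is
    \<open>B ^ r * D / \<mu>\<close>.\<close>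
  have lnZ: "ln (real r ^ (2 * r) * Z) = real r * L + ln D"
  proof -
    have "real r ^ (2 * r) * Z = B ^ r * (D / \<mu>)"
      using r0 by (simp add: Z_def power_divide power_mult)
    then show ?thesis
      using B r0 by (simp add: L_def ln_mult ln_div ln_realpow algebra_simps)
  qed
  have Fh: "(\<integral>t. F (0 + real r * y) t \<partial>lborel) = h y" for y
  proof -
    have wy: "w (0 + real r * y) = Complex (1 / 2) y"
      using r0 by (simp add: w_def c_def complex_eq_iff)
    have Cy: "Complex c (0 + real r * y) = of_nat r * Complex (1 / 2) y"
      by (simp add: c_def complex_eq_iff)
    have "real r ^ (2 * r) * Z > 0" using Z r0 by simp
    then have "of_real (real r ^ (2 * r) * Z) powr (- Complex (1 / 2) y) =
        exp (- Complex (1 / 2) y * of_real (real r * L + ln D))"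
      unfolding lnZ[symmetric] by (rule complex_powr_exp_ln)
    also have "\<dots> = exp (- (of_nat r * Complex (1 / 2) y * of_real L)) * exp (- (Complex (1 / 2) y * of_real (ln D)))"
      by (simp add: algebra_simps flip: exp_add)
    finally show ?thesis
      unfolding F_def integral_mult_right_zero intS(2) wy E_def \<Phi>_def Cy h_def by (simp add: mult_ac)
  qed
  have "of_real (2 * pi * (\<integral>t. indicator {0<..} t * (H t / (t + D)) \<partial>lborel)) =
      (\<integral>t. complex_of_real (2 * pi * (indicator {0<..} t * (H t / (t + D)))) \<partial>lborel)"
    by (simp only: integral_complex_of_real integral_mult_right_zero)
  also have "\<dots> = (\<integral>t. (\<integral>y. F y t \<partial>lborel) \<partial>lborel)" unfolding inner ..
  also have "\<dots> = (\<integral>y. (\<integral>t. F y t \<partial>lborel) \<partial>lborel)" by (rule lborel_pair.Fubini_integral[OF int])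
  also have "\<dots> = of_nat r * (\<integral>y. h y \<partial>lborel)"
    unfolding Fh[symmetric] using r0
    by (subst lborel_integral_real_affine[of "real r" _ 0]) (simp_all add: scaleR_conv_of_real)
  finally have I: "of_real (2 * pi * (\<integral>t. indicator {0<..} t * (H t / (t + D)) \<partial>lborel)) =
      of_nat r * (\<integral>y. h y \<partial>lborel)" .
  \<comment> \<open>Origin of the prefactor: it is \<open>r / k\<close>, with \<open>r\<close> the
    Jacobian of \<open>s = r t\<close> and \<open>k\<close> the constant that the capacity function
    carries.\<close>
  have kr: "real r powr (\<alpha> + \<nu> - 1) / (2 * pi) ^ (r - 1) * k = real r"
  proof -
    have "real r powr (\<alpha> + \<nu> - 1) * real r powr (2 - \<alpha> - \<nu>) = real r"
      using r0 by (simp flip: powr_add)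
    then show ?thesis by (simp add: k_def)
  qed
  have "of_real (real r powr (\<alpha> + \<nu> - 1) / (2 * pi) ^ (r - 1)) * (of_real k * (\<integral>y. h y \<partial>lborel) / (2 * of_real pi)) =
      of_real (real r powr (\<alpha> + \<nu> - 1) / (2 * pi) ^ (r - 1) * k) * (\<integral>y. h y \<partial>lborel) / (2 * of_real pi)"
    by simp
  also have "\<dots> = of_nat r * (\<integral>y. h y \<partial>lborel) / (2 * of_real pi)" unfolding kr by simp
  also have "\<dots> = of_real (\<integral>t. indicator {0<..} t * (H t / (t + D)) \<partial>lborel)"
    unfolding I[symmetric] by simp
  finally show "of_real (\<integral>t. indicator {0<..} t * (H t / (t + D)) \<partial>lborel) =
      of_real (real r powr (\<alpha> + \<nu> - 1) / (2 * pi) ^ (r - 1)) *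
      meijer_G (3 * r + 1) 1 (map of_real (0 # Delta r (x + 1)))
        (map of_real (Delta r x @ Delta r \<alpha> @ Delta r \<nu> @ [0]))
        (of_real ((B / (real r)\<^sup>2) ^ r * (D / \<mu>)))"
    unfolding G[symmetric] Z_def ..
qed

section \<open>Ergodic capacity\<close>

lemma has_density_AE:
  assumes X: "has_density P X f" and f: "\<And>x. \<not> Q x \<Longrightarrow> f x \<le> 0"
  shows "AE w in P. Q (X w)"
proof -
  have D: "distributed P lborel X (\<lambda>x. ennreal (f x))" using X by (simp add: has_density_def)
  have "Q x" if "0 < ennreal (f x)" for x
    using f[of x] that by (cases "Q x") (auto simp: ennreal_neg)
  then have "AE x in density lborel (\<lambda>x. ennreal (f x)). Q x"
    using distributed_borel_measurable[OF D] by (subst AE_density) auto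
  then show ?thesis
    unfolding distributed_distr_eq_density[OF D, symmetric] by (rule AE_distrD[OF distributed_measurable[OF D]])
qed

text \<open>\<open>distributed\<close> gives measurability of
  \<open>\<lambda>x. ennreal (f x)\<close> only, and the optical \<open>f\<close> is built from
  definite descriptions. The measurable \<open>f'\<close>, which agrees with \<open>f\<close> almost
  everywhere because \<open>f\<close> is almost everywhere nonnegative, replaces it.\<close>

lemma has_density_integral:
  assumes X: "has_density P X f" and g [measurable]: "g \<in> borel_measurable borel"
    and int: "integrable lborel (\<lambda>x. f x * g x)"
  shows "integrable P (\<lambda>w. g (X w))" "(\<integral>w. g (X w) \<partial>P) = (\<integral>x. f x * g x \<partial>lborel)"
proof -
  have D: "distributed P lborel X (\<lambda>x. ennreal (f x))" using X by (simp add: has_density_def)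
  define f' where "f' = (\<lambda>x. enn2real (ennreal (f x)))"
  have [measurable]: "f' \<in> borel_measurable borel"
    unfolding f'_def using distributed_borel_measurable[OF D] by simp
  have D': "distributed P lborel X (\<lambda>x. ennreal (f' x))" using D by (simp add: f'_def)
  have ae: "AE x in lborel. f x * g x = f' x * g x"
    using X unfolding has_density_def by (auto simp: f'_def)
  have m: "(\<lambda>x. f x * g x) \<in> borel_measurable lborel" using int by simp
  have int': "integrable lborel (\<lambda>x. f' x * g x)"
    by (rule integrable_cong_AE_imp[OF int _ ae]) simp
  show "integrable P (\<lambda>w. g (X w))"
    using distributed_integrable[OF D', of g] int' by (simp add: f'_def)
  have "(\<integral>x. f x * g x \<partial>lborel) = (\<integral>x. f' x * g x \<partial>lborel)"
    using m by (intro integral_cong_AE ae) auto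
  then show "(\<integral>w. g (X w) \<partial>P) = (\<integral>x. f x * g x \<partial>lborel)"
    using distributed_integral[OF D', of g] by (simp add: f'_def)
qed

lemma integrable_rf_density_mean:
  assumes m: "1 \<le> m" "m \<le> M" and \<rho>: "\<rho> \<le> 1" and \<mu>: "0 < \<mu>"
  shows "integrable lborel (\<lambda>x. rf_density M m \<rho> \<mu> x * x)"
proof -
  define d where "d = (\<lambda>k. (real (M - m + k) * (1 - \<rho>) + 1) * \<mu>)"
  have d: "d k > 0" for k using \<rho> \<mu> by (simp add: d_def add_nonneg_pos)
  define a where "a = (\<lambda>k. real (M - m + k + 1) / d k)"
  have a: "a k > 0" for k using d[of k] by (simp add: a_def)
  define b where "b = (\<lambda>k. real m * real (M choose m) * ((- 1) ^ k * real ((m - 1) choose k) / d k))"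
  \<comment> \<open>Each summand is a Gamma integrand of exponent 2, as
    \<open>exp ((2 - 1) * ln x)\<close> is \<open>x\<close> for positive \<open>x\<close>; the rates
    \<open>a k\<close> are positive because \<open>\<rho> \<le> 1\<close>.\<close>
  have "rf_density M m \<rho> \<mu> x * x =
      (\<Sum>k=0..m-1. b k * (indicator {0<..} x * (exp ((2 - 1) * ln x) * exp (- (a k * x)))))" for x
  proof (cases "x > 0")
    case True
    then show ?thesis
      by (simp add: rf_density_def b_def a_def d_def sum_distrib_left sum_distrib_right mult_ac)
  next
    case False
    then show ?thesis by (cases "x = 0") (auto simp: rf_density_def)
  qed
  then show ?thesis
    using a by (simp only:) (intro Bochner_Integration.integrable_sum integrable_mult_right
        Gamma_integral_scaled_real, auto)
qed

section \<open>Jensen's inequality by tangents\<close>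

lemma frac_tangent:
  fixes x i \<delta> :: real
  assumes "x \<ge> 0" "i \<ge> 0" "\<delta> \<ge> 0"
  shows "x / (\<delta> * x + 1) \<le> i / (\<delta> * i + 1) + (x - i) / (\<delta> * i + 1)\<^sup>2"
proof -
  have p: "\<delta> * x + 1 > 0" "\<delta> * i + 1 > 0" using assms by (auto intro: add_nonneg_pos)
  \<comment> \<open>The gap between the function and its tangent at \<open>i\<close>, whose slope is
    \<open>1 / (\<delta> * i + 1)\<^sup>2\<close>, in a closed form with visible sign.\<close>
  have "i / (\<delta> * i + 1) + (x - i) / (\<delta> * i + 1)\<^sup>2 - x / (\<delta> * x + 1) =
      \<delta> * (x - i)\<^sup>2 / ((\<delta> * i + 1)\<^sup>2 * (\<delta> * x + 1))"
    using p by (simp add: divide_simps) (simp add: algebra_simps power2_eq_square)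
  also have "\<dots> \<ge> 0" using p assms by simp
  finally show ?thesis by simp
qed

lemma ln_tangent:
  fixes y y0 :: real
  assumes "y > 0" "y0 > 0"
  shows "ln y \<le> ln y0 + (y - y0) / y0"
proof -
  have "ln (y / y0) \<le> y / y0 - 1" using assms by (intro ln_le_minus_one) auto
  then show ?thesis using assms by (simp add: ln_div diff_divide_distrib)
qed

text \<open>
  Jensen's inequality with the tangent at the mean, which avoids discussing whether \<open>X\<close> vanishes.
\<close>

lemma (in prob_space) capacity_Jensen:
  fixes X :: "'a \<Rightarrow> real"
  assumes X: "integrable M X" "AE w in M. X w \<ge> 0" and \<delta>: "\<delta> \<ge> 0" and \<omega>: "\<omega> \<ge> 0"
  defines "i \<equiv> expectation X"
  shows "integrable M (\<lambda>w. log 2 (1 + \<omega> * (X w / (\<delta> * X w + 1))))"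
    and "expectation (\<lambda>w. log 2 (1 + \<omega> * (X w / (\<delta> * X w + 1)))) \<le> log 2 (1 + \<omega> * i / (\<delta> * i + 1))"
proof -
  have [measurable]: "X \<in> borel_measurable M" using X(1) by simp
  have i: "i \<ge> 0" unfolding i_def using X(2) by (rule integral_nonneg_AE)
  define y0 where "y0 = 1 + \<omega> * (i / (\<delta> * i + 1))"
  have y0: "y0 > 0" using i \<delta> \<omega> by (simp add: y0_def add_pos_nonneg)
  have l2: "ln (2::real) > 0" by simp
  have pos: "1 + \<omega> * (x / (\<delta> * x + 1)) \<ge> 1" if "x \<ge> 0" for x
    using that \<delta> \<omega> by simp
  \<comment> \<open>By the chain rule, the slope of
    \<open>log 2 (1 + \<omega> * (x / (\<delta> * x + 1)))\<close> at the mean \<open>i\<close>,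
    where the inner value is \<open>y0\<close>.\<close>
  define K where "K = \<omega> / ((\<delta> * i + 1)\<^sup>2 * y0 * ln 2)"
  have tangent: "log 2 (1 + \<omega> * (x / (\<delta> * x + 1))) \<le> log 2 y0 + K * (x - i)" if x: "x \<ge> 0" for x
  proof -
    have "ln (1 + \<omega> * (x / (\<delta> * x + 1))) \<le> ln y0 + (1 + \<omega> * (x / (\<delta> * x + 1)) - y0) / y0"
      using pos[OF x] y0 by (intro ln_tangent) auto
    also have "1 + \<omega> * (x / (\<delta> * x + 1)) - y0 = \<omega> * (x / (\<delta> * x + 1) - i / (\<delta> * i + 1))"
      by (simp add: y0_def algebra_simps)
    also have "\<omega> * (x / (\<delta> * x + 1) - i / (\<delta> * i + 1)) / y0 \<le> \<omega> * ((x - i) / (\<delta> * i + 1)\<^sup>2) / y0"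
      using frac_tangent[OF x i \<delta>] y0 \<omega> by (intro divide_right_mono mult_left_mono) auto
    finally have "ln (1 + \<omega> * (x / (\<delta> * x + 1))) / ln 2 \<le> (ln y0 + \<omega> * ((x - i) / (\<delta> * i + 1)\<^sup>2) / y0) / ln 2"
      using l2 by (intro divide_right_mono) auto
    then show ?thesis by (simp add: log_def K_def add_divide_distrib mult_ac)
  qed
  \<comment> \<open>Integrability: the logarithm is nonnegative and grows at most linearly, by
    \<open>ln (1 + u) \<le> u\<close>.\<close>
  have bound: "norm (log 2 (1 + \<omega> * (x / (\<delta> * x + 1)))) \<le> \<omega> / ln 2 * x" if x: "x \<ge> 0" for x
  proof -
    have "x / (\<delta> * x + 1) \<le> x / 1"
      using x \<delta> by (intro divide_left_mono) (auto intro: add_nonneg_pos)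
    then have "ln (1 + \<omega> * (x / (\<delta> * x + 1))) \<le> \<omega> * x"
      using ln_add_one_self_le_self[of "\<omega> * (x / (\<delta> * x + 1))"] pos[OF x] \<omega>
        mult_left_mono[of "x / (\<delta> * x + 1)" x \<omega>] by auto
    moreover have "ln (1 + \<omega> * (x / (\<delta> * x + 1))) \<ge> 0" using pos[OF x] by simp
    ultimately show ?thesis by (simp add: log_def divide_right_mono)
  qed
  show int: "integrable M (\<lambda>w. log 2 (1 + \<omega> * (X w / (\<delta> * X w + 1))))"
  proof (rule Bochner_Integration.integrable_bound)
    show "integrable M (\<lambda>w. \<omega> / ln 2 * X w)" using X(1) by simp
    show "AE w in M. norm (log 2 (1 + \<omega> * (X w / (\<delta> * X w + 1)))) \<le> norm (\<omega> / ln 2 * X w)"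
      using X(2) by eventually_elim (metis bound abs_ge_self order.trans real_norm_def)
  qed measurable
  have "expectation (\<lambda>w. log 2 (1 + \<omega> * (X w / (\<delta> * X w + 1)))) \<le>
      expectation (\<lambda>w. log 2 y0 + K * (X w - i))"
  proof (rule integral_mono_AE[OF int])
    show "integrable M (\<lambda>w. log 2 y0 + K * (X w - i))" using X(1) by simp
    show "AE w in M. log 2 (1 + \<omega> * (X w / (\<delta> * X w + 1))) \<le> log 2 y0 + K * (X w - i)"
      using X(2) by eventually_elim (rule tangent)
  qed
  also have "\<dots> = log 2 y0" using X(1) by (simp add: i_def prob_space)
  finally show "expectation (\<lambda>w. log 2 (1 + \<omega> * (X w / (\<delta> * X w + 1)))) \<le> log 2 (1 + \<omega> * i / (\<delta> * i + 1))"
    by (simp add: y0_def)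
qed

text \<open>With \<open>D = C / q\<close> the weight is \<open>x / (q * (x + D))\<close>, and its
  \<open>x\<close> cancels the \<open>1 / x\<close> of the density. What remains is the Stieltjes
  kernel against each Meijer summand; this puts \<open>q\<close> into the prefactor and
  \<open>C / (q * \<mu>)\<close> into the argument.\<close>

lemma optical_density_mean:
  fixes r \<beta> :: nat and g \<Omega> :: real
  assumes r: "r \<in> {1, 2}" and pos: "0 < \<mu>" "0 < \<xi>" "0 < \<alpha>" "0 < B" "0 < C" "0 < q"
  defines "f \<equiv> optical_density r \<mu> \<xi> \<alpha> \<beta> g \<Omega> B"
  shows "integrable lborel (\<lambda>x. f x * (x / (q * x + C)))"
    and "complex_of_real (\<integral>x. f x * (x / (q * x + C)) \<partial>lborel) =
        of_real (\<xi>\<^sup>2 * malaga_A \<alpha> \<beta> g \<Omega> / (2 ^ r * (2 * pi) ^ (r - 1) * q)) *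
        (\<Sum>n=1..\<beta>. of_real (malaga_b \<alpha> \<beta> g \<Omega> n * real r powr (\<alpha> + real n - 1)) *
           meijer_G (3 * r + 1) 1
             (map of_real (0 # Delta r (\<xi>\<^sup>2 + 1)))
             (map of_real (Delta r (\<xi>\<^sup>2) @ Delta r \<alpha> @ Delta r (real n) @ [0]))
             (of_real ((B / (real r)\<^sup>2) ^ r * (C / (q * \<mu>)))))"
proof -
  define D where "D = C / q"
  have D: "D > 0" using pos by (simp add: D_def)
  define H where "H = (\<lambda>(n::nat) t::real. Re (meijer_G 3 0 [of_real (\<xi>\<^sup>2 + 1)]
      [of_real (\<xi>\<^sup>2), of_real \<alpha>, of_real (real n)] (of_real (B * (t / \<mu>) powr (1 / real r)))))"
  define G where "G = (\<lambda>n::nat. meijer_G (3 * r + 1) 1 (map of_real (0 # Delta r (\<xi>\<^sup>2 + 1)))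
      (map of_real (Delta r (\<xi>\<^sup>2) @ Delta r \<alpha> @ Delta r (real n) @ [0]))
      (of_real ((B / (real r)\<^sup>2) ^ r * (D / \<mu>))))"
  let ?J = "\<lambda>n t. indicator {0<..} t * (H n t / (t + D))"
  have S: "integrable lborel (?J n)"
    "complex_of_real (\<integral>t. ?J n t \<partial>lborel) =
      of_real (real r powr (\<alpha> + real n - 1) / (2 * pi) ^ (r - 1)) * G n" if "n \<ge> 1" for n
    unfolding H_def G_def
    by (rule Stieltjes_transform_meijer_G; use r pos D that in simp)+
  define k where "k = \<xi>\<^sup>2 * malaga_A \<alpha> \<beta> g \<Omega> / (2 ^ r * q)"
  have eq: "f x * (x / (q * x + C)) = k * (\<Sum>n=1..\<beta>. malaga_b \<alpha> \<beta> g \<Omega> n * ?J n x)" for x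
  proof (cases "x > 0")
    case True
    have "q * x + C = q * (x + D)" using pos by (simp add: D_def field_simps)
    then have "x / (q * x + C) = x * (1 / (q * (x + D)))" by simp
    then show ?thesis using True
      by (simp add: f_def optical_density_def k_def H_def sum_distrib_left sum_distrib_right mult_ac)
  qed (simp add: f_def optical_density_def)
  have int: "integrable lborel (\<lambda>x. malaga_b \<alpha> \<beta> g \<Omega> n * ?J n x)" if "n \<in> {1..\<beta>}" for n
    by (intro integrable_mult_right S) (use that in simp)
  show "integrable lborel (\<lambda>x. f x * (x / (q * x + C)))"
    unfolding eq by (rule integrable_mult_right, rule Bochner_Integration.integrable_sum, rule int)
  have "complex_of_real (\<integral>x. f x * (x / (q * x + C)) \<partial>lborel) =
      of_real k * (\<Sum>n=1..\<beta>. of_real (malaga_b \<alpha> \<beta> g \<Omega> n) * of_real (\<integral>t. ?J n t \<partial>lborel))"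
    unfolding eq integral_mult_right_zero using int
    by (subst Bochner_Integration.integral_sum) (simp_all only: integral_mult_right_zero of_real_mult of_real_sum)
  also have "\<dots> = of_real k * (\<Sum>n=1..\<beta>. of_real (malaga_b \<alpha> \<beta> g \<Omega> n) *
      (of_real (real r powr (\<alpha> + real n - 1) / (2 * pi) ^ (r - 1)) * G n))"
    using S(2) by (intro arg_cong2[where f = "(*)"] sum.cong refl) auto
  also have "\<dots> = of_real (k / (2 * pi) ^ (r - 1)) *
      (\<Sum>n=1..\<beta>. of_real (malaga_b \<alpha> \<beta> g \<Omega> n * real r powr (\<alpha> + real n - 1)) * G n)"
    by (simp add: sum_distrib_left mult_ac)
  finally show "complex_of_real (\<integral>x. f x * (x / (q * x + C)) \<partial>lborel) =
        of_real (\<xi>\<^sup>2 * malaga_A \<alpha> \<beta> g \<Omega> / (2 ^ r * (2 * pi) ^ (r - 1) * q)) *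
        (\<Sum>n=1..\<beta>. of_real (malaga_b \<alpha> \<beta> g \<Omega> n * real r powr (\<alpha> + real n - 1)) *
           meijer_G (3 * r + 1) 1
             (map of_real (0 # Delta r (\<xi>\<^sup>2 + 1)))
             (map of_real (Delta r (\<xi>\<^sup>2) @ Delta r \<alpha> @ Delta r (real n) @ [0]))
             (of_real ((B / (real r)\<^sup>2) ^ r * (C / (q * \<mu>)))))"
    by (simp add: k_def G_def D_def mult_ac)
qed

text \<open>Integrability is part of the conclusion because the integral of a non-integrable
  function is 0 by default; with it the expectations are genuine. The value of \<open>I\<close> is
  stated as a complex equation, which includes that the sum of Meijer functions is real.\<close>

theorem theorem1:
  fixes P :: "'a measure"
    and \<gamma>\<^sub>1 \<gamma>\<^sub>2 \<gamma> :: "'a \<Rightarrow> real"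
    and M m r \<beta> :: nat
    and \<rho> \<mu>\<^sub>1 \<mu>\<^sub>r \<xi> \<alpha> g \<Omega> B \<kappa>\<^sub>1 \<kappa>\<^sub>2 \<delta> C \<omega> I :: real
  assumes "prob_space P"
    and "1 \<le> m" "m \<le> M" "0 \<le> \<rho>" "\<rho> \<le> 1" "0 < \<mu>\<^sub>1"
    and "r \<in> {1, 2}" "0 < \<mu>\<^sub>r" "0 < \<xi>" "0 < \<alpha>" "1 \<le> \<beta>" "0 < g" "0 < \<Omega>" "0 < B"
    and "0 \<le> \<kappa>\<^sub>1" "0 \<le> \<kappa>\<^sub>2"
    and "has_density P \<gamma>\<^sub>1 (rf_density M m \<rho> \<mu>\<^sub>1)"
    and "has_density P \<gamma>\<^sub>2 (optical_density r \<mu>\<^sub>r \<xi> \<alpha> \<beta> g \<Omega> B)"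
    and "prob_space.indep_var P borel \<gamma>\<^sub>1 borel \<gamma>\<^sub>2"
    and "\<delta> = \<kappa>\<^sub>1\<^sup>2 + \<kappa>\<^sub>2\<^sup>2 + \<kappa>\<^sub>1\<^sup>2 * \<kappa>\<^sub>2\<^sup>2"
    and "C = (\<integral>w. \<gamma>\<^sub>1 w \<partial>P) * (1 + \<kappa>\<^sub>1\<^sup>2) + 1"
    and "\<gamma> = (\<lambda>w. \<gamma>\<^sub>1 w * \<gamma>\<^sub>2 w / (\<delta> * \<gamma>\<^sub>1 w * \<gamma>\<^sub>2 w + (1 + \<kappa>\<^sub>2\<^sup>2) * \<gamma>\<^sub>2 w + C))"
    and "\<omega> = (if r = 1 then 1 else exp 1 / (2 * pi))"
    and "I = (\<integral>w. \<gamma>\<^sub>1 w * \<gamma>\<^sub>2 w / ((1 + \<kappa>\<^sub>2\<^sup>2) * \<gamma>\<^sub>2 w + C) \<partial>P)"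
  shows "integrable P \<gamma>\<^sub>1
    \<and> integrable P (\<lambda>w. log 2 (1 + \<omega> * \<gamma> w))
    \<and> integrable P (\<lambda>w. \<gamma>\<^sub>1 w * \<gamma>\<^sub>2 w / ((1 + \<kappa>\<^sub>2\<^sup>2) * \<gamma>\<^sub>2 w + C))
    \<and> (\<integral>w. log 2 (1 + \<omega> * \<gamma> w) \<partial>P) \<le> log 2 (1 + \<omega> * I / (\<delta> * I + 1))
    \<and> complex_of_real I =
        of_real (\<xi>\<^sup>2 * malaga_A \<alpha> \<beta> g \<Omega> * (\<integral>w. \<gamma>\<^sub>1 w \<partial>P)
                   / (2 ^ r * (2 * pi) ^ (r - 1) * (1 + \<kappa>\<^sub>2\<^sup>2))) *
        (\<Sum>n=1..\<beta>. of_real (malaga_b \<alpha> \<beta> g \<Omega> n * real r powr (\<alpha> + real n - 1)) *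
           meijer_G (3 * r + 1) 1
             (map of_real (0 # Delta r (\<xi>\<^sup>2 + 1)))
             (map of_real (Delta r (\<xi>\<^sup>2) @ Delta r \<alpha> @ Delta r (real n) @ [0]))
             (of_real ((B / (real r)\<^sup>2) ^ r * (C / ((1 + \<kappa>\<^sub>2\<^sup>2) * \<mu>\<^sub>r)))))"
proof -
  interpret prob_space P by fact
  note density = \<open>has_density P \<gamma>\<^sub>1 (rf_density M m \<rho> \<mu>\<^sub>1)\<close>
    \<open>has_density P \<gamma>\<^sub>2 (optical_density r \<mu>\<^sub>r \<xi> \<alpha> \<beta> g \<Omega> B)\<close>
  have int1: "integrable P \<gamma>\<^sub>1"
    using has_density_integral(1)[OF density(1), of "\<lambda>x. x"] assms
    by (simp add: integrable_rf_density_mean)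
  have pos1: "AE w in P. \<gamma>\<^sub>1 w \<ge> 0"
    using has_density_AE[OF density(1), of "\<lambda>x. x \<ge> 0"] by (simp add: rf_density_def)
  have pos2: "AE w in P. \<gamma>\<^sub>2 w > 0"
    using has_density_AE[OF density(2), of "\<lambda>x. x > 0"] by (simp add: optical_density_def)
  have "expectation \<gamma>\<^sub>1 \<ge> 0" using pos1 by (rule integral_nonneg_AE)
  then have C: "C > 0"
    unfolding \<open>C = _\<close> by (intro add_nonneg_pos mult_nonneg_nonneg) auto
  define q where "q = 1 + \<kappa>\<^sub>2\<^sup>2"
  have q: "q > 0" by (simp add: q_def add_pos_nonneg)
  \<comment> \<open>The ratio is \<open>\<gamma>\<^sub>1 * h(\<gamma>\<^sub>2)\<close>, a product of
    independent variables; its mean is a product, which is where the factor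
    \<open>expectation \<gamma>\<^sub>1\<close> comes from.\<close>
  define h where "h = (\<lambda>x. x / (q * x + C))"
  have [measurable]: "h \<in> borel_measurable borel" unfolding h_def by measurable
  note mean = optical_density_mean[OF \<open>r \<in> {1, 2}\<close> \<open>0 < \<mu>\<^sub>r\<close> \<open>0 < \<xi>\<close> \<open>0 < \<alpha>\<close> \<open>0 < B\<close> C q,
      where g = g and \<Omega> = \<Omega> and \<beta> = \<beta>]
  have int2: "integrable P (\<lambda>w. h (\<gamma>\<^sub>2 w))"
    and mean2: "expectation (\<lambda>w. h (\<gamma>\<^sub>2 w)) =
      (\<integral>x. optical_density r \<mu>\<^sub>r \<xi> \<alpha> \<beta> g \<Omega> B x * h x \<partial>lborel)"
    using has_density_integral[OF density(2), of h] mean(1) by (simp_all add: h_def)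
  have "indep_var borel ((\<lambda>x. x) \<circ> \<gamma>\<^sub>1) borel (h \<circ> \<gamma>\<^sub>2)"
    by (rule indep_var_compose[OF \<open>indep_var borel \<gamma>\<^sub>1 borel \<gamma>\<^sub>2\<close>]) measurable
  then have indep: "indep_var borel \<gamma>\<^sub>1 borel (\<lambda>w. h (\<gamma>\<^sub>2 w))" by (simp add: o_def)
  define X where "X = (\<lambda>w. \<gamma>\<^sub>1 w * \<gamma>\<^sub>2 w / (q * \<gamma>\<^sub>2 w + C))"
  have X: "X = (\<lambda>w. \<gamma>\<^sub>1 w * h (\<gamma>\<^sub>2 w))" by (simp add: X_def h_def)
  have intX: "integrable P X"
    unfolding X by (rule indep_var_integrable[OF indep int1 int2])
  have I: "I = expectation X" unfolding \<open>I = _\<close> X_def q_def ..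
  have meanX: "I = expectation \<gamma>\<^sub>1 * expectation (\<lambda>w. h (\<gamma>\<^sub>2 w))"
    unfolding I X by (rule indep_var_lebesgue_integral[OF indep int1 int2])
  have posX: "AE w in P. X w \<ge> 0"
    using pos1 pos2 by eventually_elim (use C q in \<open>simp add: X_def\<close>)
  have \<delta>: "\<delta> \<ge> 0" unfolding \<open>\<delta> = _\<close> by simp
  have \<omega>: "\<omega> \<ge> 0" unfolding \<open>\<omega> = _\<close> by simp
  \<comment> \<open>Divide numerator and denominator by \<open>y\<close>. Its positivity rests on
    that of \<open>\<gamma>\<^sub>2\<close>, which is known only almost surely.\<close>
  have \<gamma>: "AE w in P. \<gamma> w = X w / (\<delta> * X w + 1)"
    using pos1 pos2
  proof eventually_elim
    case (elim w)
    define y where "y = q * \<gamma>\<^sub>2 w + C"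
    have y: "y > 0" using elim C q by (simp add: y_def add_nonneg_pos)
    have "\<gamma> w = \<gamma>\<^sub>1 w * \<gamma>\<^sub>2 w / (\<delta> * (\<gamma>\<^sub>1 w * \<gamma>\<^sub>2 w) + y)"
      unfolding \<open>\<gamma> = _\<close> y_def q_def by (simp add: algebra_simps)
    also have "\<dots> = (\<gamma>\<^sub>1 w * \<gamma>\<^sub>2 w / y) / (\<delta> * (\<gamma>\<^sub>1 w * \<gamma>\<^sub>2 w / y) + 1)"
    proof -
      have "\<delta> * (\<gamma>\<^sub>1 w * \<gamma>\<^sub>2 w / y) + 1 = (\<delta> * (\<gamma>\<^sub>1 w * \<gamma>\<^sub>2 w) + y) / y"
        using y by (simp add: field_simps)
      then show ?thesis using y by simp
    qed
    finally show ?case by (simp add: X_def y_def)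
  qed
  have [measurable]: "\<gamma>\<^sub>1 \<in> borel_measurable P" "X \<in> borel_measurable P" "\<gamma>\<^sub>2 \<in> borel_measurable P"
    using int1 intX density(2) by (auto simp: has_density_def distributed_def)
  have [measurable]: "\<gamma> \<in> borel_measurable P" unfolding \<open>\<gamma> = _\<close> by measurable
  have log_\<gamma>: "AE w in P. log 2 (1 + \<omega> * (X w / (\<delta> * X w + 1))) = log 2 (1 + \<omega> * \<gamma> w)"
    using \<gamma> by eventually_elim simp
  note jensen = capacity_Jensen[OF intX posX \<delta> \<omega>]
  have int\<gamma>: "integrable P (\<lambda>w. log 2 (1 + \<omega> * \<gamma> w))"
    by (rule integrable_cong_AE_imp[OF jensen(1) _ log_\<gamma>]) measurable
  have "expectation (\<lambda>w. log 2 (1 + \<omega> * \<gamma> w)) =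
      expectation (\<lambda>w. log 2 (1 + \<omega> * (X w / (\<delta> * X w + 1))))"
    using log_\<gamma> by (intro integral_cong_AE) auto
  then have bound: "expectation (\<lambda>w. log 2 (1 + \<omega> * \<gamma> w)) \<le> log 2 (1 + \<omega> * I / (\<delta> * I + 1))"
    using jensen(2) unfolding I by simp
  have "complex_of_real I = of_real (expectation \<gamma>\<^sub>1) * of_real (expectation (\<lambda>w. h (\<gamma>\<^sub>2 w)))"
    unfolding meanX by simp
  then have value_I: "complex_of_real I = of_real (\<xi>\<^sup>2 * malaga_A \<alpha> \<beta> g \<Omega> * expectation \<gamma>\<^sub>1
        / (2 ^ r * (2 * pi) ^ (r - 1) * q)) *
      (\<Sum>n=1..\<beta>. of_real (malaga_b \<alpha> \<beta> g \<Omega> n * real r powr (\<alpha> + real n - 1)) *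
         meijer_G (3 * r + 1) 1
           (map of_real (0 # Delta r (\<xi>\<^sup>2 + 1)))
           (map of_real (Delta r (\<xi>\<^sup>2) @ Delta r \<alpha> @ Delta r (real n) @ [0]))
           (of_real ((B / (real r)\<^sup>2) ^ r * (C / (q * \<mu>\<^sub>r)))))"
    unfolding mean2 unfolding h_def mean(2) by (simp add: mult_ac)
  show ?thesis
    using int1 int\<gamma> intX[unfolded X_def q_def] bound value_I[unfolded q_def] by blast
qed

end
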